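(* Let $\mathcal{Q}$ be any relatively congruence-distributive quasivariety. Then $\mathcal{Q}$ has the $\mathcal{Q}$-congruence extension property if and only if $\mathcal{Q}_{\mathrm{RFSI}}=\mathcal{Q}_{\mathrm{FSI}}$ has the $\mathcal{Q}$-congruence extension property.
   Context: A quasivariety $\mathcal{Q}$ is a class of algebras of the same signature closed under isomorphisms, subalgebras, direct products, and ultraproducts (equivalently, defined by quasiequations). For $\mathbf{A}\in\mathcal{Q}$, a congruence $\Theta$ of $\mathbf{A}$ is a $\mathcal{Q}$-congruence if $\mathbf{A}/\Theta\in\mathcal{Q}$; the $\mathcal{Q}$-congruences of $\mathbf{A}$ ordered by inclusion form an algebraic lattice $\mathrm{Con}_{\mathcal{Q}}\,\mathbf{A}$. $\mathcal{Q}$ is relatively congruence-distributive if $\mathrm{Con}_{\mathcal{Q}}\,\mathbf{A}$ is a distributive lattice for every $\mathbf{A}\in\mathcal{Q}$. An element $a$ of a lattice is meet-irreducible if $a=b\wedge c$ implies $a=b$ or $a=c$ (so a greatest element is meet-irreducible). Write $\Delta_A=\{\langle a,a\rangle\mid a\in A\}$. $\mathcal{Q}_{\mathrm{RFSI}}$ is the class of $\mathbf{A}\in\mathcal{Q}$ such that $\Delta_A$ is meet-irreducible in $\mathrm{Con}_{\mathcal{Q}}\,\mathbf{A}$ (relatively finitely subdirectly irreducible members), and $\mathcal{Q}_{\mathrm{FSI}}$ is the class of $\mathbf{A}\in\mathcal{Q}$ such that $\Delta_A$ is meet-irreducible in the lattice $\mathrm{Con}\,\mathbf{A}$ of all congruences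 of $\mathbf{A}$ (finitely subdirectly irreducible members). Trivial algebras belong to both. It is a known fact that $\mathcal{Q}_{\mathrm{RFSI}}=\mathcal{Q}_{\mathrm{FSI}}$ whenever $\mathcal{Q}$ is relatively congruence-distributive. An algebra $\mathbf{B}\in\mathcal{Q}$ has the $\mathcal{Q}$-congruence extension property if for any subalgebra $\mathbf{A}$ of $\mathbf{B}$ and $\Theta\in\mathrm{Con}_{\mathcal{Q}}\,\mathbf{A}$ there exists a $\Phi\in\mathrm{Con}_{\mathcal{Q}}\,\mathbf{B}$ with $\Phi\cap A^2=\Theta$. A class $\mathcal{K}\subseteq\mathcal{Q}$ has the $\mathcal{Q}$-congruence extension property if every member of $\mathcal{K}$ does. *)

theory Defs
  imports "HOL-Algebra.Lattice"
begin

record 'f signature =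
  symbols :: "'f set"
  arity :: "'f \<Rightarrow> nat"

record ('a, 'f) ualg = "'a partial_object" +
  opr :: "'f \<Rightarrow> 'a list \<Rightarrow> 'a"

(* Carriers are nonempty. The values of opr outside the symbols of the signature, on argument lists
   of the wrong length and on arguments outside the carrier are irrelevant. *)
definition algebra_of :: "'f signature \<Rightarrow> ('a, 'f) ualg \<Rightarrow> bool" where
  "algebra_of \<sigma> A \<longleftrightarrow> carrier A \<noteq> {} \<and>
     (\<forall>f \<in> symbols \<sigma>. \<forall>xs \<in> lists (carrier A). length xs = arity \<sigma> f \<longrightarrow> opr A f xs \<in> carrier A)"

definition subalgebra :: "'f signature \<Rightarrow> ('a, 'f) ualg \<Rightarrow> ('a, 'f) ualg \<Rightarrow> bool" where
  "subalgebra \<sigma> A B \<longleftrightarrow> algebra_of \<sigma> A \<and> carrier A \<subseteq> carrier B \<and>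
     (\<forall>f \<in> symbols \<sigma>. \<forall>xs \<in> lists (carrier A).
        length xs = arity \<sigma> f \<longrightarrow> opr A f xs = opr B f xs)"

datatype 'f trm = Var nat | App 'f "'f trm list"

fun wf_trm :: "'f signature \<Rightarrow> 'f trm \<Rightarrow> bool" where
  "wf_trm \<sigma> (Var x) \<longleftrightarrow> True"
| "wf_trm \<sigma> (App f ts) \<longleftrightarrow> f \<in> symbols \<sigma> \<and> length ts = arity \<sigma> f \<and> (\<forall>t \<in> set ts. wf_trm \<sigma> t)"

fun eval_trm :: "('a, 'f) ualg \<Rightarrow> (nat \<Rightarrow> 'a) \<Rightarrow> 'f trm \<Rightarrow> 'a" where
  "eval_trm A v (Var x) = v x"
| "eval_trm A v (App f ts) = opr A f (map (eval_trm A v) ts)"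

type_synonym 'f equation = "'f trm \<times> 'f trm"

datatype 'f quasieq = Quasieq (prems: "'f equation list") (concl: "'f equation")

definition wf_equation :: "'f signature \<Rightarrow> 'f equation \<Rightarrow> bool" where
  "wf_equation \<sigma> e \<longleftrightarrow> wf_trm \<sigma> (fst e) \<and> wf_trm \<sigma> (snd e)"

definition wf_quasieq :: "'f signature \<Rightarrow> 'f quasieq \<Rightarrow> bool" where
  "wf_quasieq \<sigma> q \<longleftrightarrow> (\<forall>e \<in> set (prems q). wf_equation \<sigma> e) \<and> wf_equation \<sigma> (concl q)"

definition holds_eq :: "('a, 'f) ualg \<Rightarrow> (nat \<Rightarrow> 'a) \<Rightarrow> 'f equation \<Rightarrow> bool" where
  "holds_eq A v e \<longleftrightarrow> eval_trm A v (fst e) = eval_trm A v (snd e)"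

definition satisfies :: "('a, 'f) ualg \<Rightarrow> 'f quasieq \<Rightarrow> bool" where
  "satisfies A q \<longleftrightarrow> (\<forall>v. (\<forall>x. v x \<in> carrier A) \<longrightarrow>
     (\<forall>e \<in> set (prems q). holds_eq A v e) \<longrightarrow> holds_eq A v (concl q))"

(* The quasivariety axiomatized by \<Sigma>. The constant is polymorphic in 'a, so a pair (\<sigma>, \<Sigma>) denotes
   one class of algebras whose members may live on any type; an instance of 'a yields the members
   whose carrier is a subset of that type. *)
definition quasivariety :: "'f signature \<Rightarrow> 'f quasieq set \<Rightarrow> ('a, 'f) ualg set" where
  "quasivariety \<sigma> \<Sigma> = {A. algebra_of \<sigma> A \<and> (\<forall>q \<in> \<Sigma>. satisfies A q)}"

definition congruence :: "'f signature \<Rightarrow> ('a, 'f) ualg \<Rightarrow> ('a \<times> 'a) set \<Rightarrow> bool" where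
  "congruence \<sigma> A \<Theta> \<longleftrightarrow> equiv (carrier A) \<Theta> \<and>
     (\<forall>f \<in> symbols \<sigma>. \<forall>xs ys. length xs = arity \<sigma> f \<longrightarrow>
        list_all2 (\<lambda>x y. (x, y) \<in> \<Theta>) xs ys \<longrightarrow> (opr A f xs, opr A f ys) \<in> \<Theta>)"

(* An operation of the quotient sends classes Xs to the union of the classes of opr A f xs over all
   choices xs of representatives; for a congruence this union is a single class. *)
definition quotient_alg :: "('a, 'f) ualg \<Rightarrow> ('a \<times> 'a) set \<Rightarrow> ('a set, 'f) ualg" where
  "quotient_alg A \<Theta> =
     \<lparr>carrier = carrier A // \<Theta>,
      opr = (\<lambda>f Xs. \<Union>xs \<in> {xs. list_all2 (\<lambda>x X. x \<in> X) xs Xs}. \<Theta> `` {opr A f xs})\<rparr>"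

definition rel_congruence ::
  "'f signature \<Rightarrow> 'f quasieq set \<Rightarrow> ('a, 'f) ualg \<Rightarrow> ('a \<times> 'a) set \<Rightarrow> bool" where
  "rel_congruence \<sigma> \<Sigma> A \<Theta> \<longleftrightarrow> congruence \<sigma> A \<Theta> \<and> quotient_alg A \<Theta> \<in> quasivariety \<sigma> \<Sigma>"

definition Con :: "'f signature \<Rightarrow> ('a, 'f) ualg \<Rightarrow> ('a \<times> 'a) set gorder" where
  "Con \<sigma> A = \<lparr>carrier = {\<Theta>. congruence \<sigma> A \<Theta>}, eq = (=), le = (\<subseteq>)\<rparr>"

definition ConQ ::
  "'f signature \<Rightarrow> 'f quasieq set \<Rightarrow> ('a, 'f) ualg \<Rightarrow> ('a \<times> 'a) set gorder" where
  "ConQ \<sigma> \<Sigma> A = \<lparr>carrier = {\<Theta>. rel_congruence \<sigma> \<Sigma> A \<Theta>}, eq = (=), le = (\<subseteq>)\<rparr>"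

definition distributive_lattice :: "'b gorder \<Rightarrow> bool" where
  "distributive_lattice L \<longleftrightarrow> lattice L \<and>
     (\<forall>x \<in> carrier L. \<forall>y \<in> carrier L. \<forall>z \<in> carrier L.
        x \<sqinter>\<^bsub>L\<^esub> (y \<squnion>\<^bsub>L\<^esub> z) = (x \<sqinter>\<^bsub>L\<^esub> y) \<squnion>\<^bsub>L\<^esub> (x \<sqinter>\<^bsub>L\<^esub> z))"

definition meet_irreducible :: "'b gorder \<Rightarrow> 'b \<Rightarrow> bool" where
  "meet_irreducible L a \<longleftrightarrow> a \<in> carrier L \<and>
     (\<forall>b \<in> carrier L. \<forall>c \<in> carrier L. a = b \<sqinter>\<^bsub>L\<^esub> c \<longrightarrow> a = b \<or> a = c)"

(* The members A range over the subsets of the type 'a, which plays the role of the universe. An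
   infinite 'a contains copies of all finite powers of its algebras. *)
definition rel_congruence_distributive ::
  "'a itself \<Rightarrow> 'f signature \<Rightarrow> 'f quasieq set \<Rightarrow> bool" where
  "rel_congruence_distributive (_ :: 'a itself) \<sigma> \<Sigma> \<longleftrightarrow>
     (\<forall>A \<in> (quasivariety \<sigma> \<Sigma> :: ('a, 'f) ualg set). distributive_lattice (ConQ \<sigma> \<Sigma> A))"

definition RFSI :: "'f signature \<Rightarrow> 'f quasieq set \<Rightarrow> ('a, 'f) ualg set" where
  "RFSI \<sigma> \<Sigma> = {A \<in> quasivariety \<sigma> \<Sigma>. meet_irreducible (ConQ \<sigma> \<Sigma> A) (Id_on (carrier A))}"

definition FSI :: "'f signature \<Rightarrow> 'f quasieq set \<Rightarrow> ('a, 'f) ualg set" where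
  "FSI \<sigma> \<Sigma> = {A \<in> quasivariety \<sigma> \<Sigma>. meet_irreducible (Con \<sigma> A) (Id_on (carrier A))}"

definition has_CEP :: "'f signature \<Rightarrow> 'f quasieq set \<Rightarrow> ('a, 'f) ualg \<Rightarrow> bool" where
  "has_CEP \<sigma> \<Sigma> B \<longleftrightarrow>
     (\<forall>A \<Theta>. subalgebra \<sigma> A B \<longrightarrow> \<Theta> \<in> carrier (ConQ \<sigma> \<Sigma> A) \<longrightarrow>
        (\<exists>\<Phi> \<in> carrier (ConQ \<sigma> \<Sigma> B). \<Phi> \<inter> (carrier A \<times> carrier A) = \<Theta>))"

definition class_has_CEP :: "'f signature \<Rightarrow> 'f quasieq set \<Rightarrow> ('a, 'f) ualg set \<Rightarrow> bool" where
  "class_has_CEP \<sigma> \<Sigma> K \<longleftrightarrow> (\<forall>B \<in> K. has_CEP \<sigma> \<Sigma> B)"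

end

theory Submission
  imports Defs
begin

text \<open>
  Let \<open>\<Q>\<close> be the quasivariety. Call a congruence \<open>\<Theta>\<close> of an algebra in \<open>\<Q>\<close> relative if its quotient
  is again in \<open>\<Q>\<close>. Relative congruences are closed under intersections, so each congruence \<open>\<Theta>\<close> has a
  relative closure \<open>rel_Cg \<Theta>\<close>, and the relative congruences form a lattice, here assumed
  distributive.

  \<^bold>\<open>Relative and absolute irreducibility agree.\<close> The content is that relative closure cannot destroy
  a trivial intersection: \<open>\<phi> \<inter> \<theta> \<subseteq> \<Xi>\<close> with \<open>\<Xi>\<close> relative implies \<open>rel_Cg \<phi> \<inter> rel_Cg \<theta> \<subseteq> \<Xi>\<close>
  (lemma \<open>extension_principle\<close>). Consider the subalgebra \<open>D\<close> of \<open>A\<^sup>3\<close> of the triples \<open>(x, y, z)\<close> with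
  \<open>(x, y) \<in> \<phi>\<close> and \<open>(y, z) \<in> \<theta>\<close>. Given \<open>x\<close> and \<open>z\<close>, the middle entry \<open>y\<close> is determined up to
  \<open>\<phi> \<inter> \<theta>\<close>, hence up to \<open>\<Xi>\<close>. So if \<open>a\<close> and \<open>b\<close> are the kernels of the outer projections and \<open>c\<close> is
  the inverse image of \<open>\<Xi>\<close> under the middle projection, then \<open>a \<inter> b \<subseteq> c\<close>, and distributivity of
  the relative congruences of \<open>D\<close> gives \<open>(a \<or> c) \<inter> (b \<or> c) = c\<close>. Now \<open>a \<or> c\<close> lies above the kernel
  of the middle projection, so it comes from a relative congruence of \<open>A\<close>. The triples \<open>(x, x, x)\<close>
  and \<open>(x, y, y)\<close> show that this congruence contains \<open>\<phi>\<close>, therefore \<open>rel_Cg \<phi>\<close>; likewise \<open>b \<or> c\<close>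
  accounts for \<open>rel_Cg \<theta>\<close>. As the whole argument takes place in a subalgebra of \<open>A\<^sup>3\<close>, infinity of
  the underlying type provides all the room that is needed.

  \<^bold>\<open>Extending congruences.\<close> Let \<open>A\<close> be a subalgebra of \<open>B\<close>. Every relative congruence of \<open>A\<close> is an
  intersection of meet-irreducible ones by Zorn's lemma, and extensions may be intersected, so only
  meet-irreducible \<open>\<Theta>\<close> have to be extended. Let \<open>\<Psi>\<close> be maximal among the relative congruences of
  \<open>B\<close> whose restriction to \<open>A\<close> is below \<open>\<Theta>\<close>. By distributivity \<open>\<Theta>\<close> is meet-prime, which makes
  \<open>\<Psi>\<close> meet-irreducible: if \<open>\<Psi> = \<Phi> \<inter> \<Phi>'\<close>, one of the restrictions of \<open>\<Phi>\<close> and \<open>\<Phi>'\<close> is below \<open>\<Theta>\<close>,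
  and maximality applies. Hence \<open>B/\<Psi>\<close> is relatively finitely subdirectly irreducible. The image of
  \<open>\<Theta>\<close> in \<open>B/\<Psi>\<close> extends by assumption, and the inverse image in \<open>B\<close> of that extension extends
  \<open>\<Theta>\<close> (lemmas \<open>extend_along_RFSI_quotient\<close>, \<open>extend_meet_irreducible\<close>).\<close>

section \<open>Homomorphisms and pullbacks\<close>

definition hom_alg ::
  "'f signature \<Rightarrow> ('a, 'f) ualg \<Rightarrow> ('b, 'f) ualg \<Rightarrow> ('a \<Rightarrow> 'b) \<Rightarrow> bool" where
  "hom_alg \<sigma> A B h \<longleftrightarrow> h ` carrier A \<subseteq> carrier B \<and>
     (\<forall>f \<in> symbols \<sigma>. \<forall>xs \<in> lists (carrier A).
        length xs = arity \<sigma> f \<longrightarrow> h (opr A f xs) = opr B f (map h xs))"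

definition pullback :: "('a, 'f) ualg \<Rightarrow> ('a \<Rightarrow> 'b) \<Rightarrow> ('b \<times> 'b) set \<Rightarrow> ('a \<times> 'a) set" where
  "pullback A h \<Theta> = {(x, y). x \<in> carrier A \<and> y \<in> carrier A \<and> (h x, h y) \<in> \<Theta>}"

text \<open>For a congruence this says that the quotient by \<open>\<Theta>\<close> satisfies \<open>\<Sigma>\<close>, but without mentioning
  quotient algebras; with \<open>\<Theta> = Id\<close> it is satisfaction in \<open>A\<close> itself. Membership in the quasivariety
  and relative congruences are thereby handled by one notion.\<close>

definition quasi_closed :: "'f quasieq set \<Rightarrow> ('a, 'f) ualg \<Rightarrow> ('a \<times> 'a) set \<Rightarrow> bool" where
  "quasi_closed \<Sigma> A \<Theta> \<longleftrightarrow> (\<forall>q \<in> \<Sigma>. \<forall>v. (\<forall>x. v x \<in> carrier A) \<longrightarrow>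
     (\<forall>e \<in> set (prems q). (eval_trm A v (fst e), eval_trm A v (snd e)) \<in> \<Theta>) \<longrightarrow>
     (eval_trm A v (fst (concl q)), eval_trm A v (snd (concl q))) \<in> \<Theta>)"

lemma quasivariety_iff:
  "A \<in> quasivariety \<sigma> \<Sigma> \<longleftrightarrow> algebra_of \<sigma> A \<and> quasi_closed \<Sigma> A Id"
  by (auto simp: quasivariety_def quasi_closed_def satisfies_def holds_eq_def)

lemma algebra_of_opr:
  "algebra_of \<sigma> A \<Longrightarrow> f \<in> symbols \<sigma> \<Longrightarrow> xs \<in> lists (carrier A) \<Longrightarrow> length xs = arity \<sigma> f \<Longrightarrow>
    opr A f xs \<in> carrier A"
  unfolding algebra_of_def by blast

lemma hom_alg_opr:
  "hom_alg \<sigma> A B h \<Longrightarrow> f \<in> symbols \<sigma> \<Longrightarrow> xs \<in> lists (carrier A) \<Longrightarrow> length xs = arity \<sigma> f \<Longrightarrow>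
    h (opr A f xs) = opr B f (map h xs)"
  unfolding hom_alg_def by blast

lemma hom_alg_closed: "hom_alg \<sigma> A B h \<Longrightarrow> x \<in> carrier A \<Longrightarrow> h x \<in> carrier B"
  unfolding hom_alg_def by blast

lemma eval_trm_closed:
  assumes "algebra_of \<sigma> A" "\<And>x. v x \<in> carrier A"
  shows "wf_trm \<sigma> t \<Longrightarrow> eval_trm A v t \<in> carrier A"
proof (induction t)
  case (App f ts)
  then show ?case
    by (auto intro!: algebra_of_opr[OF assms(1)])
qed (use assms in simp)

lemma hom_alg_eval_trm:
  assumes "hom_alg \<sigma> A B h" "algebra_of \<sigma> A" "\<And>x. v x \<in> carrier A"
  shows "wf_trm \<sigma> t \<Longrightarrow> h (eval_trm A v t) = eval_trm B (h \<circ> v) t"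
proof (induction t)
  case (App f ts)
  have "map (eval_trm A v) ts \<in> lists (carrier A)"
    using App.prems eval_trm_closed[OF assms(2,3)] by auto
  then have "h (opr A f (map (eval_trm A v) ts)) = opr B f (map h (map (eval_trm A v) ts))"
    using App.prems hom_alg_opr[OF assms(1)] by auto
  also have "map h (map (eval_trm A v) ts) = map (eval_trm B (h \<circ> v)) ts"
    using App by (auto simp: comp_def)
  finally show ?case by (simp only: eval_trm.simps)
qed simp

lemma quasi_closed_pullback:
  assumes wf: "\<forall>q \<in> \<Sigma>. wf_quasieq \<sigma> q"
    and hom: "hom_alg \<sigma> A B h" and alg: "algebra_of \<sigma> A" and cl: "quasi_closed \<Sigma> B \<Theta>"
  shows "quasi_closed \<Sigma> A (pullback A h \<Theta>)"
  unfolding quasi_closed_def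
proof (intro ballI allI impI)
  fix q v
  assume q: "q \<in> \<Sigma>" and v: "\<forall>x. v x \<in> carrier A"
    and p: "\<forall>e \<in> set (prems q). (eval_trm A v (fst e), eval_trm A v (snd e)) \<in> pullback A h \<Theta>"
  have wfq: "\<And>e. e \<in> set (prems q) \<Longrightarrow> wf_equation \<sigma> e" "wf_equation \<sigma> (concl q)"
    using wf q by (auto simp: wf_quasieq_def)
  note ev = hom_alg_eval_trm[OF hom alg, of v] and ec = eval_trm_closed[OF alg, of v]
  have hv: "\<forall>x. (h \<circ> v) x \<in> carrier B" using v hom_alg_closed[OF hom] by auto
  have "\<forall>e \<in> set (prems q). (eval_trm B (h \<circ> v) (fst e), eval_trm B (h \<circ> v) (snd e)) \<in> \<Theta>"
    using p wfq(1) v ev by (fastforce simp: pullback_def wf_equation_def)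
  then have "(eval_trm B (h \<circ> v) (fst (concl q)), eval_trm B (h \<circ> v) (snd (concl q))) \<in> \<Theta>"
    using cl q hv unfolding quasi_closed_def by blast
  then show "(eval_trm A v (fst (concl q)), eval_trm A v (snd (concl q))) \<in> pullback A h \<Theta>"
    using wfq(2) v ev ec by (auto simp: pullback_def wf_equation_def)
qed

text \<open>Surjectivity lets every valuation in \<open>B\<close> be lifted to \<open>A\<close>, so nothing that could violate closure
  is missed by the pullback.\<close>

lemma quasi_closed_of_pullback:
  assumes wf: "\<forall>q \<in> \<Sigma>. wf_quasieq \<sigma> q"
    and hom: "hom_alg \<sigma> A B h" and alg: "algebra_of \<sigma> A" and surj: "h ` carrier A = carrier B"
    and cl: "quasi_closed \<Sigma> A (pullback A h \<Theta>)"
  shows "quasi_closed \<Sigma> B \<Theta>"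
  unfolding quasi_closed_def
proof (intro ballI allI impI)
  fix q w
  assume q: "q \<in> \<Sigma>" and w: "\<forall>x. w x \<in> carrier B"
    and p: "\<forall>e \<in> set (prems q). (eval_trm B w (fst e), eval_trm B w (snd e)) \<in> \<Theta>"
  have wfq: "\<And>e. e \<in> set (prems q) \<Longrightarrow> wf_equation \<sigma> e" "wf_equation \<sigma> (concl q)"
    using wf q by (auto simp: wf_quasieq_def)
  have "\<forall>x. \<exists>u. u \<in> carrier A \<and> h u = w x" using w surj by (metis imageE)
  then obtain v where v: "\<forall>x. v x \<in> carrier A" and hv: "\<forall>x. h (v x) = w x" by metis
  have w_eq: "w = h \<circ> v" using hv by auto
  note ev = hom_alg_eval_trm[OF hom alg, of v] and ec = eval_trm_closed[OF alg, of v]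
  have "\<forall>e \<in> set (prems q). (eval_trm A v (fst e), eval_trm A v (snd e)) \<in> pullback A h \<Theta>"
    using p wfq(1) v ev ec by (auto simp: pullback_def wf_equation_def w_eq)
  then have "(eval_trm A v (fst (concl q)), eval_trm A v (snd (concl q))) \<in> pullback A h \<Theta>"
    using cl q v unfolding quasi_closed_def by blast
  then show "(eval_trm B w (fst (concl q)), eval_trm B w (snd (concl q))) \<in> \<Theta>"
    using wfq(2) v ev by (auto simp: pullback_def wf_equation_def w_eq)
qed

lemma congruence_opr:
  "congruence \<sigma> A \<Theta> \<Longrightarrow> f \<in> symbols \<sigma> \<Longrightarrow> length xs = arity \<sigma> f \<Longrightarrow>
    list_all2 (\<lambda>x y. (x, y) \<in> \<Theta>) xs ys \<Longrightarrow> (opr A f xs, opr A f ys) \<in> \<Theta>"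
  unfolding congruence_def by blast

lemma congruence_equiv: "congruence \<sigma> A \<Theta> \<Longrightarrow> equiv (carrier A) \<Theta>"
  unfolding congruence_def by blast

lemma equiv_props:
  assumes "equiv C \<Theta>"
  shows "x \<in> C \<Longrightarrow> (x, x) \<in> \<Theta>" "(x, y) \<in> \<Theta> \<Longrightarrow> (y, x) \<in> \<Theta>"
    "(x, y) \<in> \<Theta> \<Longrightarrow> (y, z) \<in> \<Theta> \<Longrightarrow> (x, z) \<in> \<Theta>"
  using assms by (auto simp: equiv_def refl_on_def dest: symD transD)

lemma congruence_subset: "congruence \<sigma> A \<Theta> \<Longrightarrow> \<Theta> \<subseteq> carrier A \<times> carrier A"
  by (drule congruence_equiv, erule equiv_type)

lemma list_all2_lists:
  assumes "\<Theta> \<subseteq> C \<times> C" "list_all2 (\<lambda>x y. (x, y) \<in> \<Theta>) xs ys"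
  shows "xs \<in> lists C" "ys \<in> lists C"
  using assms(2,1) by (induction rule: list_all2_induct) auto

lemma congruence_pullback:
  assumes hom: "hom_alg \<sigma> A B h" and alg: "algebra_of \<sigma> A" and con: "congruence \<sigma> B \<Theta>"
  shows "congruence \<sigma> A (pullback A h \<Theta>)"
proof -
  have eq: "equiv (carrier B) \<Theta>" by (rule congruence_equiv[OF con])
  have "equiv (carrier A) (pullback A h \<Theta>)"
  proof (rule equivI)
    show "refl_on (carrier A) (pullback A h \<Theta>)"
      using hom_alg_closed[OF hom] equiv_props(1)[OF eq] by (auto simp: refl_on_def pullback_def)
    show "sym (pullback A h \<Theta>)"
      using equiv_props(2)[OF eq] by (auto simp: sym_def pullback_def)
    show "trans (pullback A h \<Theta>)"
      using equiv_props(3)[OF eq] unfolding trans_def pullback_def by blast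
  qed (auto simp: pullback_def)
  moreover have "(opr A f xs, opr A f ys) \<in> pullback A h \<Theta>"
    if f: "f \<in> symbols \<sigma>" "length xs = arity \<sigma> f"
      and l: "list_all2 (\<lambda>x y. (x, y) \<in> pullback A h \<Theta>) xs ys" for f xs ys
  proof -
    have "pullback A h \<Theta> \<subseteq> carrier A \<times> carrier A" by (auto simp: pullback_def)
    note xy = list_all2_lists[OF this l]
    have ly: "length ys = arity \<sigma> f" using l f list_all2_lengthD by metis
    have "list_all2 (\<lambda>x y. (x, y) \<in> \<Theta>) (map h xs) (map h ys)"
      using l by (auto simp: list_all2_conv_all_nth pullback_def)
    then have "(opr B f (map h xs), opr B f (map h ys)) \<in> \<Theta>"
      using congruence_opr[OF con f(1)] f(2) by simp
    then show ?thesis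
      using hom_alg_opr[OF hom f(1)] algebra_of_opr[OF alg f(1)] xy f(2) ly
      by (auto simp: pullback_def)
  qed
  ultimately show ?thesis unfolding congruence_def by blast
qed

lemma congruence_of_pullback:
  assumes hom: "hom_alg \<sigma> A B h" and surj: "h ` carrier A = carrier B"
    and sub: "\<Theta> \<subseteq> carrier B \<times> carrier B" and con: "congruence \<sigma> A (pullback A h \<Theta>)"
  shows "congruence \<sigma> B \<Theta>"
proof -
  have eq: "equiv (carrier A) (pullback A h \<Theta>)" by (rule congruence_equiv[OF con])
  have lift: "\<exists>u \<in> carrier A. h u = x" if "x \<in> carrier B" for x using that surj by (metis imageE)
  have "equiv (carrier B) \<Theta>"
  proof (rule equivI)
    show "refl_on (carrier B) \<Theta>"
      using equiv_props(1)[OF eq] by (auto simp: refl_on_def pullback_def surj[symmetric])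
    show "sym \<Theta>"
    proof (rule symI)
      fix x y assume xy: "(x, y) \<in> \<Theta>"
      then have "x \<in> carrier B" "y \<in> carrier B" using sub by auto
      with lift obtain u v where "u \<in> carrier A" "v \<in> carrier A" "h u = x" "h v = y"
        by metis
      then show "(y, x) \<in> \<Theta>"
        using xy equiv_props(2)[OF eq, of u v] by (auto simp: pullback_def)
    qed
    show "trans \<Theta>"
    proof (rule transI)
      fix x y z assume xy: "(x, y) \<in> \<Theta>" and yz: "(y, z) \<in> \<Theta>"
      then have "x \<in> carrier B" "y \<in> carrier B" "z \<in> carrier B" using sub by auto
      with lift obtain u v w where "u \<in> carrier A" "v \<in> carrier A" "w \<in> carrier A"
        "h u = x" "h v = y" "h w = z"
        by metis
      moreover from this have "(u, v) \<in> pullback A h \<Theta>" "(v, w) \<in> pullback A h \<Theta>"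
        using xy yz by (auto simp: pullback_def)
      ultimately have "(u, w) \<in> pullback A h \<Theta>"
        using equiv_props(3)[OF eq] by blast
      then show "(x, z) \<in> \<Theta>" using \<open>h u = x\<close> \<open>h w = z\<close> by (auto simp: pullback_def)
    qed
  qed (rule sub)
  moreover have "(opr B f xs, opr B f ys) \<in> \<Theta>"
    if f: "f \<in> symbols \<sigma>" "length xs = arity \<sigma> f"
      and l: "list_all2 (\<lambda>x y. (x, y) \<in> \<Theta>) xs ys" for f xs ys
  proof -
    from list_all2_lists[OF sub l] obtain us vs
      where us: "us \<in> lists (carrier A)" "xs = map h us"
        and vs: "vs \<in> lists (carrier A)" "ys = map h vs"
      unfolding surj[symmetric] lists_image by blast
    have "list_all2 (\<lambda>x y. (x, y) \<in> pullback A h \<Theta>) us vs"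
      using l us vs by (auto simp: list_all2_conv_all_nth pullback_def)
    moreover have len: "length us = arity \<sigma> f" "length vs = arity \<sigma> f"
      using f l us vs by (auto dest: list_all2_lengthD)
    ultimately have "(opr A f us, opr A f vs) \<in> pullback A h \<Theta>"
      using congruence_opr[OF con f(1)] by blast
    then show ?thesis
      using hom_alg_opr[OF hom f(1)] us vs len by (auto simp: pullback_def)
  qed
  ultimately show ?thesis unfolding congruence_def by blast
qed

lemma algebra_of_surj_image:
  assumes "hom_alg \<sigma> A B h" "algebra_of \<sigma> A" "h ` carrier A = carrier B"
  shows "algebra_of \<sigma> B"
  unfolding algebra_of_def
proof (intro conjI ballI impI)
  show "carrier B \<noteq> {}" using assms(2,3) by (auto simp: algebra_of_def)
  fix f xs assume f: "f \<in> symbols \<sigma>" "length xs = arity \<sigma> f" and "xs \<in> lists (carrier B)"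
  then obtain us where us: "us \<in> lists (carrier A)" "xs = map h us"
    unfolding assms(3)[symmetric] lists_image by blast
  then have "opr B f xs = h (opr A f us)" using hom_alg_opr[OF assms(1)] f by simp
  then show "opr B f xs \<in> carrier B"
    using algebra_of_opr[OF assms(2) f(1) us(1)] f us assms(3) by auto
qed

section \<open>Relative congruences seen from inside the algebra\<close>

text \<open>The operations of the quotient are unions over all choices of representatives; that the classes
  united are all the same is where compatibility of \<open>\<Theta>\<close> with the operations enters.\<close>

lemma quotient_hom:
  assumes alg: "algebra_of \<sigma> A" and con: "congruence \<sigma> A \<Theta>"
  shows "hom_alg \<sigma> A (quotient_alg A \<Theta>) (\<lambda>x. \<Theta> `` {x})"
  unfolding hom_alg_def
proof (intro conjI ballI impI)
  show "(\<lambda>x. \<Theta> `` {x}) ` carrier A \<subseteq> carrier (quotient_alg A \<Theta>)"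
    by (auto simp: quotient_alg_def intro: quotientI)
  fix f us assume f: "f \<in> symbols \<sigma>" and us: "us \<in> lists (carrier A)" "length us = arity \<sigma> f"
  have eq: "equiv (carrier A) \<Theta>" by (rule congruence_equiv[OF con])
  let ?R = "{xs. list_all2 (\<lambda>x X. x \<in> X) xs (map (\<lambda>x. \<Theta> `` {x}) us)}"
  have "us \<in> ?R"
    using us equiv_props(1)[OF eq] by (auto simp: list_all2_conv_all_nth)
  moreover have "\<Theta> `` {opr A f xs} = \<Theta> `` {opr A f us}" if "xs \<in> ?R" for xs
  proof -
    have "list_all2 (\<lambda>x y. (x, y) \<in> \<Theta>) us xs"
      using that by (auto simp: list_all2_conv_all_nth)
    from congruence_opr[OF con f us(2) this] show ?thesis
      using equiv_class_eq[OF eq] by metis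
  qed
  ultimately have "(\<Union>xs \<in> ?R. \<Theta> `` {opr A f xs}) = \<Theta> `` {opr A f us}" by blast
  then show "\<Theta> `` {opr A f us} = opr (quotient_alg A \<Theta>) f (map (\<lambda>x. \<Theta> `` {x}) us)"
    by (simp add: quotient_alg_def)
qed

text \<open>The projection onto the quotient is surjective and pulls \<open>Id\<close> back to \<open>\<Theta>\<close>, so satisfaction in the
  quotient is closure of \<open>\<Theta>\<close>. From here on quotient algebras are no longer needed.\<close>

lemma rel_congruence_iff:
  assumes wf: "\<forall>q \<in> \<Sigma>. wf_quasieq \<sigma> q" and alg: "algebra_of \<sigma> A"
  shows "rel_congruence \<sigma> \<Sigma> A \<Theta> \<longleftrightarrow> congruence \<sigma> A \<Theta> \<and> quasi_closed \<Sigma> A \<Theta>"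
proof (cases "congruence \<sigma> A \<Theta>")
  case True
  let ?h = "\<lambda>x. \<Theta> `` {x}"
  have hom: "hom_alg \<sigma> A (quotient_alg A \<Theta>) ?h" by (rule quotient_hom[OF alg True])
  have surj: "?h ` carrier A = carrier (quotient_alg A \<Theta>)"
    by (auto simp: quotient_alg_def quotient_def)
  have "pullback A ?h Id = \<Theta>"
    using eq_equiv_class_iff[OF congruence_equiv[OF True]] congruence_subset[OF True]
    by (auto simp: pullback_def)
  then show ?thesis
    using True quasi_closed_pullback[OF wf hom alg, of Id]
      quasi_closed_of_pullback[OF wf hom alg surj, of Id] algebra_of_surj_image[OF hom alg surj]
    by (auto simp: rel_congruence_def quasivariety_iff)
qed (simp add: rel_congruence_def)

lemma rel_congruence_congruence: "rel_congruence \<sigma> \<Sigma> A \<Theta> \<Longrightarrow> congruence \<sigma> A \<Theta>"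
  by (simp add: rel_congruence_def)

lemma rel_congruence_subset: "rel_congruence \<sigma> \<Sigma> A \<Theta> \<Longrightarrow> \<Theta> \<subseteq> carrier A \<times> carrier A"
  by (rule congruence_subset[OF rel_congruence_congruence])

lemma rel_congruence_pullback:
  assumes "\<forall>q \<in> \<Sigma>. wf_quasieq \<sigma> q" "hom_alg \<sigma> A B h" "algebra_of \<sigma> A" "algebra_of \<sigma> B"
    "rel_congruence \<sigma> \<Sigma> B \<Theta>"
  shows "rel_congruence \<sigma> \<Sigma> A (pullback A h \<Theta>)"
  using assms by (simp add: rel_congruence_iff quasi_closed_pullback congruence_pullback)

lemma rel_congruence_of_pullback:
  assumes wf: "\<forall>q \<in> \<Sigma>. wf_quasieq \<sigma> q"
    and hom: "hom_alg \<sigma> A B h" and alg: "algebra_of \<sigma> A" and surj: "h ` carrier A = carrier B"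
    and sub: "\<Theta> \<subseteq> carrier B \<times> carrier B"
    and rc: "rel_congruence \<sigma> \<Sigma> A (pullback A h \<Theta>)"
  shows "rel_congruence \<sigma> \<Sigma> B \<Theta>"
  using rc algebra_of_surj_image[OF hom alg surj]
    congruence_of_pullback[OF hom surj sub] quasi_closed_of_pullback[OF wf hom alg surj]
  by (simp add: rel_congruence_iff[OF wf] alg)

text \<open>The correspondence theorem: a relative congruence above the kernel of a surjective homomorphism
  is the pullback of a relative congruence of the image.\<close>

lemma rel_congruence_image:
  assumes wf: "\<forall>q \<in> \<Sigma>. wf_quasieq \<sigma> q"
    and hom: "hom_alg \<sigma> A B h" and alg: "algebra_of \<sigma> A" and surj: "h ` carrier A = carrier B"
    and rc: "rel_congruence \<sigma> \<Sigma> A \<Gamma>" and ker: "pullback A h Id \<subseteq> \<Gamma>"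
  shows "pullback A h (map_prod h h ` \<Gamma>) = \<Gamma>" "rel_congruence \<sigma> \<Sigma> B (map_prod h h ` \<Gamma>)"
proof -
  have eq: "equiv (carrier A) \<Gamma>" by (rule congruence_equiv[OF rel_congruence_congruence[OF rc]])
  have sub: "\<Gamma> \<subseteq> carrier A \<times> carrier A" by (rule rel_congruence_subset[OF rc])
  show pb: "pullback A h (map_prod h h ` \<Gamma>) = \<Gamma>"
  proof
    show "pullback A h (map_prod h h ` \<Gamma>) \<subseteq> \<Gamma>"
    proof clarify
      fix x y assume "(x, y) \<in> pullback A h (map_prod h h ` \<Gamma>)"
      then obtain u v where uv: "(u, v) \<in> \<Gamma>" "h x = h u" "h v = h y"
        and c: "x \<in> carrier A" "y \<in> carrier A"
        by (auto simp: pullback_def)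
      have "(x, u) \<in> \<Gamma>" "(v, y) \<in> \<Gamma>"
        using uv c sub ker by (auto simp: pullback_def)
      then show "(x, y) \<in> \<Gamma>" using uv(1) equiv_props(3)[OF eq] by blast
    qed
    show "\<Gamma> \<subseteq> pullback A h (map_prod h h ` \<Gamma>)" using sub by (force simp: pullback_def)
  qed
  show "rel_congruence \<sigma> \<Sigma> B (map_prod h h ` \<Gamma>)"
    by (rule rel_congruence_of_pullback[OF wf hom alg surj])
      (use sub surj in fastforce, simp add: pb rc)
qed

text \<open>An algebra separated by homomorphisms into \<open>A\<close> embeds into a power of \<open>A\<close>. In this form closure of
  the quasivariety under subalgebras and powers needs no construction of the power.\<close>

lemma quasivariety_separated:
  assumes wf: "\<forall>q \<in> \<Sigma>. wf_quasieq \<sigma> q" and alg: "algebra_of \<sigma> D" and A: "A \<in> quasivariety \<sigma> \<Sigma>"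
    and hom: "\<And>h. h \<in> H \<Longrightarrow> hom_alg \<sigma> D A h"
    and sep: "\<And>x y. x \<in> carrier D \<Longrightarrow> y \<in> carrier D \<Longrightarrow> (\<And>h. h \<in> H \<Longrightarrow> h x = h y) \<Longrightarrow> x = y"
  shows "D \<in> quasivariety \<sigma> \<Sigma>"
proof -
  have "quasi_closed \<Sigma> D Id"
    unfolding quasi_closed_def
  proof (intro ballI allI impI)
    fix q v
    assume q: "q \<in> \<Sigma>" and v: "\<forall>x. v x \<in> carrier D"
      and p: "\<forall>e \<in> set (prems q). (eval_trm D v (fst e), eval_trm D v (snd e)) \<in> Id"
    have wfq: "\<And>e. e \<in> set (prems q) \<Longrightarrow> wf_equation \<sigma> e" "wf_equation \<sigma> (concl q)"
      using wf q by (auto simp: wf_quasieq_def)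
    note ec = eval_trm_closed[OF alg, of v]
    have "h (eval_trm D v (fst (concl q))) = h (eval_trm D v (snd (concl q)))" if "h \<in> H" for h
    proof -
      have "quasi_closed \<Sigma> D (pullback D h Id)"
        using quasi_closed_pullback[OF wf hom[OF that] alg] A by (simp add: quasivariety_iff)
      moreover have "\<forall>e \<in> set (prems q).
          (eval_trm D v (fst e), eval_trm D v (snd e)) \<in> pullback D h Id"
        using p wfq(1) ec v by (auto simp: pullback_def wf_equation_def)
      ultimately have "(eval_trm D v (fst (concl q)), eval_trm D v (snd (concl q)))
          \<in> pullback D h Id"
        using q v unfolding quasi_closed_def by blast
      then show ?thesis by (simp add: pullback_def)
    qed
    then show "(eval_trm D v (fst (concl q)), eval_trm D v (snd (concl q))) \<in> Id"
      using sep ec v wfq(2) by (auto simp: wf_equation_def)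
  qed
  with alg show ?thesis by (simp add: quasivariety_iff)
qed

section \<open>The lattice of relative congruences\<close>

lemma rel_congruence_Inter:
  assumes wf: "\<forall>q \<in> \<Sigma>. wf_quasieq \<sigma> q" and alg: "algebra_of \<sigma> A"
    and ne: "S \<noteq> {}" and S: "\<And>\<Theta>. \<Theta> \<in> S \<Longrightarrow> rel_congruence \<sigma> \<Sigma> A \<Theta>"
  shows "rel_congruence \<sigma> \<Sigma> A (\<Inter>S)"
proof -
  have eq: "equiv (carrier A) \<Theta>" if "\<Theta> \<in> S" for \<Theta>
    using S[OF that] congruence_equiv rel_congruence_congruence by blast
  have "equiv (carrier A) (\<Inter>S)"
  proof (rule equivI)
    show "\<Inter>S \<subseteq> carrier A \<times> carrier A" using ne rel_congruence_subset[OF S] by blast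
    show "refl_on (carrier A) (\<Inter>S)" using eq by (auto simp: equiv_def refl_on_def)
    show "sym (\<Inter>S)" using eq by (auto simp: equiv_def sym_def)
    show "trans (\<Inter>S)" using eq unfolding equiv_def trans_def by blast
  qed
  moreover have "(opr A f xs, opr A f ys) \<in> \<Inter>S"
    if "f \<in> symbols \<sigma>" "length xs = arity \<sigma> f" "list_all2 (\<lambda>x y. (x, y) \<in> \<Inter>S) xs ys" for f xs ys
  proof
    fix \<Theta> assume \<Theta>: "\<Theta> \<in> S"
    have "list_all2 (\<lambda>x y. (x, y) \<in> \<Theta>) xs ys"
      using that(3) \<Theta> by (auto elim: list_all2_mono)
    then show "(opr A f xs, opr A f ys) \<in> \<Theta>"
      by (rule congruence_opr[OF rel_congruence_congruence[OF S[OF \<Theta>]] that(1,2)])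
  qed
  moreover have "quasi_closed \<Sigma> A (\<Inter>S)"
    unfolding quasi_closed_def
  proof (intro ballI allI impI InterI)
    fix q v \<Theta>
    assume q: "q \<in> \<Sigma>" and v: "\<forall>x. v x \<in> carrier A" and \<Theta>: "\<Theta> \<in> S"
      and p: "\<forall>e \<in> set (prems q). (eval_trm A v (fst e), eval_trm A v (snd e)) \<in> \<Inter>S"
    have "quasi_closed \<Sigma> A \<Theta>" using S[OF \<Theta>] rel_congruence_iff[OF wf alg] by metis
    moreover have "\<forall>e \<in> set (prems q). (eval_trm A v (fst e), eval_trm A v (snd e)) \<in> \<Theta>"
      using p \<Theta> by auto
    ultimately show "(eval_trm A v (fst (concl q)), eval_trm A v (snd (concl q))) \<in> \<Theta>"
      using q v by (simp add: quasi_closed_def)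
  qed
  ultimately show ?thesis unfolding rel_congruence_iff[OF wf alg] congruence_def by blast
qed

lemma rel_congruence_Int:
  assumes "\<forall>q \<in> \<Sigma>. wf_quasieq \<sigma> q" "algebra_of \<sigma> A"
    "rel_congruence \<sigma> \<Sigma> A \<Theta>" "rel_congruence \<sigma> \<Sigma> A \<Phi>"
  shows "rel_congruence \<sigma> \<Sigma> A (\<Theta> \<inter> \<Phi>)"
  using rel_congruence_Inter[OF assms(1,2), of "{\<Theta>, \<Phi>}"] assms(3,4) by auto

lemma congruence_Int:
  assumes alg: "algebra_of \<sigma> A" and "congruence \<sigma> A \<Theta>" "congruence \<sigma> A \<Phi>"
  shows "congruence \<sigma> A (\<Theta> \<inter> \<Phi>)"
  \<comment> \<open>For the empty set of quasiequations all congruences are relative ones.\<close>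
  using rel_congruence_Int[of "{}" \<sigma> A \<Theta> \<Phi>] assms
  by (simp add: rel_congruence_iff quasi_closed_def)

lemma rel_congruence_total:
  assumes wf: "\<forall>q \<in> \<Sigma>. wf_quasieq \<sigma> q" and alg: "algebra_of \<sigma> A"
  shows "rel_congruence \<sigma> \<Sigma> A (carrier A \<times> carrier A)"
proof -
  have "congruence \<sigma> A (carrier A \<times> carrier A)"
    unfolding congruence_def
  proof (intro conjI ballI allI impI)
    show "equiv (carrier A) (carrier A \<times> carrier A)"
      by (rule equivI) (auto simp: refl_on_def sym_def trans_def)
    fix f xs ys
    assume f: "f \<in> symbols \<sigma>" "length xs = arity \<sigma> f"
      and l: "list_all2 (\<lambda>x y. (x, y) \<in> carrier A \<times> carrier A) xs ys"
    show "(opr A f xs, opr A f ys) \<in> carrier A \<times> carrier A"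
      using list_all2_lists[OF subset_refl l] list_all2_lengthD[OF l] f algebra_of_opr[OF alg f(1)]
      by auto
  qed
  moreover have "quasi_closed \<Sigma> A (carrier A \<times> carrier A)"
    using wf eval_trm_closed[OF alg]
    by (auto simp: quasi_closed_def wf_quasieq_def wf_equation_def)
  ultimately show ?thesis by (simp add: rel_congruence_iff[OF wf alg])
qed

lemma congruence_Id_on: "algebra_of \<sigma> A \<Longrightarrow> congruence \<sigma> A (Id_on (carrier A))"
  unfolding congruence_def
proof (intro conjI ballI allI impI)
  show "equiv (carrier A) (Id_on (carrier A))"
    by (rule equivI) (auto simp: refl_on_def sym_def trans_def)
  fix f xs ys
  assume alg: "algebra_of \<sigma> A" and f: "f \<in> symbols \<sigma>" "length xs = arity \<sigma> f"
    and l: "list_all2 (\<lambda>x y. (x, y) \<in> Id_on (carrier A)) xs ys"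
  have "xs = ys" using l by (auto simp: list_all2_conv_all_nth list_eq_iff_nth_eq)
  moreover have "xs \<in> lists (carrier A)" by (rule list_all2_lists[OF _ l]) auto
  ultimately show "(opr A f xs, opr A f ys) \<in> Id_on (carrier A)"
    using algebra_of_opr[OF alg f(1)] f(2) by auto
qed

lemma rel_congruence_Id_on:
  assumes wf: "\<forall>q \<in> \<Sigma>. wf_quasieq \<sigma> q" and A: "A \<in> quasivariety \<sigma> \<Sigma>"
  shows "rel_congruence \<sigma> \<Sigma> A (Id_on (carrier A))"
proof -
  have alg: "algebra_of \<sigma> A" and cl: "quasi_closed \<Sigma> A Id" using A by (auto simp: quasivariety_iff)
  have "hom_alg \<sigma> A A (\<lambda>x. x)" by (auto simp: hom_alg_def)
  moreover have Id_on_eq: "pullback A (\<lambda>x. x) Id = Id_on (carrier A)"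
    by (auto simp: pullback_def)
  ultimately
  have "quasi_closed \<Sigma> A (Id_on (carrier A))"
    using quasi_closed_pullback[OF wf _ alg cl] by metis
  with congruence_Id_on[OF alg] show ?thesis by (simp add: rel_congruence_iff[OF wf alg])
qed

text \<open>Argument lists and premise lists are finite, so all pairs involved in one instance of a closure
  condition already lie in one member of the chain. This is what makes Zorn's lemma applicable.\<close>

lemma rel_congruence_Union_chain:
  assumes wf: "\<forall>q \<in> \<Sigma>. wf_quasieq \<sigma> q" and alg: "algebra_of \<sigma> A"
    and ch: "subset.chain UNIV S" and ne: "S \<noteq> {}"
    and S: "\<And>\<Theta>. \<Theta> \<in> S \<Longrightarrow> rel_congruence \<sigma> \<Sigma> A \<Theta>"
  shows "rel_congruence \<sigma> \<Sigma> A (\<Union>S)"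
proof -
  have fin: "\<exists>\<Theta> \<in> S. F \<subseteq> \<Theta>" if "finite F" "F \<subseteq> \<Union>S" for F
    using finite_subset_Union_chain[OF that ne ch] by blast
  have eq: "equiv (carrier A) \<Theta>" if "\<Theta> \<in> S" for \<Theta>
    using S[OF that] congruence_equiv rel_congruence_congruence by blast
  have "equiv (carrier A) (\<Union>S)"
  proof (rule equivI)
    show "\<Union>S \<subseteq> carrier A \<times> carrier A" using rel_congruence_subset[OF S] by blast
    show "refl_on (carrier A) (\<Union>S)" using eq ne by (fastforce simp: equiv_def refl_on_def)
    show "sym (\<Union>S)" using eq by (fastforce simp: equiv_def sym_def)
    show "trans (\<Union>S)"
    proof (rule transI)
      fix x y z assume "(x, y) \<in> \<Union>S" "(y, z) \<in> \<Union>S"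
      then obtain \<Theta> where \<Theta>: "\<Theta> \<in> S" "{(x, y), (y, z)} \<subseteq> \<Theta>"
        using fin[of "{(x, y), (y, z)}"] by auto
      then have "(x, z) \<in> \<Theta>" using equiv_props(3)[OF eq[OF \<Theta>(1)], of x y z] by simp
      with \<Theta>(1) show "(x, z) \<in> \<Union>S" by (rule UnionI)
    qed
  qed
  moreover have "(opr A f xs, opr A f ys) \<in> \<Union>S"
    if f: "f \<in> symbols \<sigma>" "length xs = arity \<sigma> f"
      and l: "list_all2 (\<lambda>x y. (x, y) \<in> \<Union>S) xs ys" for f xs ys
  proof -
    have "set (zip xs ys) \<subseteq> \<Union>S" using l by (auto simp: list_all2_iff)
    then obtain \<Theta> where \<Theta>: "\<Theta> \<in> S" "set (zip xs ys) \<subseteq> \<Theta>" using fin by blast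
    then have "list_all2 (\<lambda>x y. (x, y) \<in> \<Theta>) xs ys" using l by (auto simp: list_all2_iff)
    then show ?thesis
      using congruence_opr[OF rel_congruence_congruence[OF S[OF \<Theta>(1)]] f] \<Theta>(1) by blast
  qed
  moreover have "quasi_closed \<Sigma> A (\<Union>S)"
    unfolding quasi_closed_def
  proof (intro ballI allI impI)
    fix q v
    assume q: "q \<in> \<Sigma>" and v: "\<forall>x. v x \<in> carrier A"
      and p: "\<forall>e \<in> set (prems q). (eval_trm A v (fst e), eval_trm A v (snd e)) \<in> \<Union>S"
    let ?F = "(\<lambda>e. (eval_trm A v (fst e), eval_trm A v (snd e))) ` set (prems q)"
    obtain \<Theta> where \<Theta>: "\<Theta> \<in> S" "?F \<subseteq> \<Theta>" using fin[of ?F] p by (auto simp: image_subset_iff)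
    then have "quasi_closed \<Sigma> A \<Theta>" using S rel_congruence_iff[OF wf alg] by metis
    then have "(eval_trm A v (fst (concl q)), eval_trm A v (snd (concl q))) \<in> \<Theta>"
      using q v \<Theta>(2) unfolding quasi_closed_def by (auto simp: image_subset_iff)
    then show "(eval_trm A v (fst (concl q)), eval_trm A v (snd (concl q))) \<in> \<Union>S"
      using \<Theta>(1) by blast
  qed
  ultimately show ?thesis unfolding rel_congruence_iff[OF wf alg] congruence_def by blast
qed

definition rel_Cg ::
  "'f signature \<Rightarrow> 'f quasieq set \<Rightarrow> ('a, 'f) ualg \<Rightarrow> ('a \<times> 'a) set \<Rightarrow> ('a \<times> 'a) set" where
  "rel_Cg \<sigma> \<Sigma> A X = \<Inter>{\<Theta>. rel_congruence \<sigma> \<Sigma> A \<Theta> \<and> X \<subseteq> \<Theta>}"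

lemma rel_congruence_rel_Cg:
  assumes "\<forall>q \<in> \<Sigma>. wf_quasieq \<sigma> q" "algebra_of \<sigma> A" "X \<subseteq> carrier A \<times> carrier A"
  shows "rel_congruence \<sigma> \<Sigma> A (rel_Cg \<sigma> \<Sigma> A X)"
  unfolding rel_Cg_def
  by (rule rel_congruence_Inter[OF assms(1,2)]) (use rel_congruence_total assms in auto)

lemma rel_congruence_join:
  assumes "\<forall>q \<in> \<Sigma>. wf_quasieq \<sigma> q" "algebra_of \<sigma> A"
    "rel_congruence \<sigma> \<Sigma> A \<Theta>" "rel_congruence \<sigma> \<Sigma> A \<Phi>"
  shows "rel_congruence \<sigma> \<Sigma> A (rel_Cg \<sigma> \<Sigma> A (\<Theta> \<union> \<Phi>))"
  using rel_congruence_rel_Cg[OF assms(1,2)] rel_congruence_subset[OF assms(3)]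
    rel_congruence_subset[OF assms(4)] by simp

lemma rel_Cg_superset: "X \<subseteq> rel_Cg \<sigma> \<Sigma> A X"
  unfolding rel_Cg_def by blast

lemma rel_Cg_least: "rel_congruence \<sigma> \<Sigma> A \<Theta> \<Longrightarrow> X \<subseteq> \<Theta> \<Longrightarrow> rel_Cg \<sigma> \<Sigma> A X \<subseteq> \<Theta>"
  unfolding rel_Cg_def by blast

lemma meet_inclusion_order:
  assumes "x \<in> S" "y \<in> S" "x \<inter> y \<in> S"
  shows "x \<sqinter>\<^bsub>\<lparr>carrier = S, eq = (=), le = (\<subseteq>)\<rparr>\<^esub> y = x \<inter> y"
  unfolding meet_def Lattice.inf_def
proof (rule some_equality)
  show greatest: "greatest \<lparr>carrier = S, eq = (=), le = (\<subseteq>)\<rparr> (x \<inter> y)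
      (Lower \<lparr>carrier = S, eq = (=), le = (\<subseteq>)\<rparr> {x, y})"
    using assms by (auto simp: greatest_def Lower_def)
  fix k assume "greatest \<lparr>carrier = S, eq = (=), le = (\<subseteq>)\<rparr> k
      (Lower \<lparr>carrier = S, eq = (=), le = (\<subseteq>)\<rparr> {x, y})"
  with greatest have "k \<subseteq> x \<inter> y" "x \<inter> y \<subseteq> k" by (simp_all add: greatest_def)
  then show "k = x \<inter> y" by (rule subset_antisym)
qed

lemma join_inclusion_order:
  assumes "x \<in> S" "y \<in> S" "j \<in> S" "x \<union> y \<subseteq> j" "\<And>z. z \<in> S \<Longrightarrow> x \<union> y \<subseteq> z \<Longrightarrow> j \<subseteq> z"
  shows "x \<squnion>\<^bsub>\<lparr>carrier = S, eq = (=), le = (\<subseteq>)\<rparr>\<^esub> y = j"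
  unfolding join_def Lattice.sup_def
proof (rule some_equality)
  show least: "least \<lparr>carrier = S, eq = (=), le = (\<subseteq>)\<rparr> j
      (Upper \<lparr>carrier = S, eq = (=), le = (\<subseteq>)\<rparr> {x, y})"
    using assms by (auto simp: least_def Upper_def)
  fix k assume "least \<lparr>carrier = S, eq = (=), le = (\<subseteq>)\<rparr> k
      (Upper \<lparr>carrier = S, eq = (=), le = (\<subseteq>)\<rparr> {x, y})"
  with least have "k \<subseteq> j" "j \<subseteq> k" by (simp_all add: least_def)
  then show "k = j" by (rule subset_antisym)
qed

lemma ConQ_distrib:
  assumes wf: "\<forall>q \<in> \<Sigma>. wf_quasieq \<sigma> q" and alg: "algebra_of \<sigma> A"
    and dist: "distributive_lattice (ConQ \<sigma> \<Sigma> A)"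
    and rc: "rel_congruence \<sigma> \<Sigma> A x" "rel_congruence \<sigma> \<Sigma> A y" "rel_congruence \<sigma> \<Sigma> A z"
  shows "x \<inter> rel_Cg \<sigma> \<Sigma> A (y \<union> z) = rel_Cg \<sigma> \<Sigma> A (x \<inter> y \<union> x \<inter> z)"
proof -
  let ?S = "{\<Theta>. rel_congruence \<sigma> \<Sigma> A \<Theta>}"
  have join: "a \<squnion>\<^bsub>ConQ \<sigma> \<Sigma> A\<^esub> b = rel_Cg \<sigma> \<Sigma> A (a \<union> b)" if "a \<in> ?S" "b \<in> ?S" for a b
    unfolding ConQ_def
    using that rel_congruence_join[OF wf alg]
    by (intro join_inclusion_order rel_Cg_superset rel_Cg_least) auto
  have meet: "a \<sqinter>\<^bsub>ConQ \<sigma> \<Sigma> A\<^esub> b = a \<inter> b" if "a \<in> ?S" "b \<in> ?S" for a b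
    unfolding ConQ_def using that rel_congruence_Int[OF wf alg]
    by (intro meet_inclusion_order) auto
  have "rel_congruence \<sigma> \<Sigma> A (rel_Cg \<sigma> \<Sigma> A (y \<union> z))"
    by (rule rel_congruence_join[OF wf alg rc(2,3)])
  moreover have "x \<sqinter>\<^bsub>ConQ \<sigma> \<Sigma> A\<^esub> (y \<squnion>\<^bsub>ConQ \<sigma> \<Sigma> A\<^esub> z)
      = (x \<sqinter>\<^bsub>ConQ \<sigma> \<Sigma> A\<^esub> y) \<squnion>\<^bsub>ConQ \<sigma> \<Sigma> A\<^esub> (x \<sqinter>\<^bsub>ConQ \<sigma> \<Sigma> A\<^esub> z)"
    using dist rc unfolding distributive_lattice_def by (auto simp: ConQ_def)
  ultimately show ?thesis
    using rc rel_congruence_Int[OF wf alg] by (simp add: join meet)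
qed

text \<open>The instance of distributivity used throughout: \<open>a \<inter> b \<subseteq> c\<close> gives
  \<open>(a \<or> c) \<inter> (b \<or> c) = (a \<inter> b) \<or> c = c\<close>. It is obtained by applying the other distributive law,
  of meet over join, to \<open>a\<close> and then to \<open>b \<or> c\<close>.\<close>

lemma ConQ_join_Int:
  assumes wf: "\<forall>q \<in> \<Sigma>. wf_quasieq \<sigma> q" and alg: "algebra_of \<sigma> A"
    and dist: "distributive_lattice (ConQ \<sigma> \<Sigma> A)"
    and a: "rel_congruence \<sigma> \<Sigma> A a" and b: "rel_congruence \<sigma> \<Sigma> A b"
    and c: "rel_congruence \<sigma> \<Sigma> A c" and abc: "a \<inter> b \<subseteq> c"
  shows "rel_Cg \<sigma> \<Sigma> A (a \<union> c) \<inter> rel_Cg \<sigma> \<Sigma> A (b \<union> c) \<subseteq> c"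
proof -
  let ?J = "rel_Cg \<sigma> \<Sigma> A"
  note distrib = ConQ_distrib[OF wf alg dist]
  have J: "rel_congruence \<sigma> \<Sigma> A (?J (b \<union> c))"
    by (rule rel_congruence_join[OF wf alg b c])
  have "a \<inter> ?J (b \<union> c) = ?J (a \<inter> b \<union> a \<inter> c)" by (rule distrib[OF a b c])
  also have "\<dots> \<subseteq> c" using abc by (intro rel_Cg_least[OF c]) blast
  finally have "a \<inter> ?J (b \<union> c) \<subseteq> c" .
  moreover have "?J (b \<union> c) \<inter> ?J (a \<union> c) = ?J (?J (b \<union> c) \<inter> a \<union> ?J (b \<union> c) \<inter> c)"
    by (rule distrib[OF J a c])
  ultimately show ?thesis using rel_Cg_least[OF c, of "?J (b \<union> c) \<inter> a \<union> ?J (b \<union> c) \<inter> c"] by blast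
qed

definition rel_meet_irreducible ::
  "'f signature \<Rightarrow> 'f quasieq set \<Rightarrow> ('a, 'f) ualg \<Rightarrow> ('a \<times> 'a) set \<Rightarrow> bool" where
  "rel_meet_irreducible \<sigma> \<Sigma> A \<Theta> \<longleftrightarrow> rel_congruence \<sigma> \<Sigma> A \<Theta> \<and>
     (\<forall>\<Phi> \<Psi>. rel_congruence \<sigma> \<Sigma> A \<Phi> \<longrightarrow> rel_congruence \<sigma> \<Sigma> A \<Psi> \<longrightarrow>
        \<Theta> = \<Phi> \<inter> \<Psi> \<longrightarrow> \<Theta> = \<Phi> \<or> \<Theta> = \<Psi>)"

lemma meet_irreducible_ConQ_iff:
  assumes wf: "\<forall>q \<in> \<Sigma>. wf_quasieq \<sigma> q" and alg: "algebra_of \<sigma> A"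
  shows "meet_irreducible (ConQ \<sigma> \<Sigma> A) \<Theta> \<longleftrightarrow> rel_meet_irreducible \<sigma> \<Sigma> A \<Theta>"
  using rel_congruence_Int[OF wf alg]
  by (auto simp: meet_irreducible_def rel_meet_irreducible_def ConQ_def meet_inclusion_order)

lemma meet_irreducible_Con_iff:
  assumes alg: "algebra_of \<sigma> A"
  shows "meet_irreducible (Con \<sigma> A) \<Theta> \<longleftrightarrow> congruence \<sigma> A \<Theta> \<and>
    (\<forall>\<Phi> \<Psi>. congruence \<sigma> A \<Phi> \<longrightarrow> congruence \<sigma> A \<Psi> \<longrightarrow> \<Theta> = \<Phi> \<inter> \<Psi> \<longrightarrow> \<Theta> = \<Phi> \<or> \<Theta> = \<Psi>)"
  using congruence_Int[OF alg]
  by (auto simp: meet_irreducible_def Con_def meet_inclusion_order)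

text \<open>In a distributive lattice, \<open>a \<inter> b \<subseteq> \<Theta>\<close> yields \<open>\<Theta> = (a \<or> \<Theta>) \<inter> (b \<or> \<Theta>)\<close>, to which irreducibility
  applies.\<close>

lemma rel_meet_irreducible_prime:
  assumes wf: "\<forall>q \<in> \<Sigma>. wf_quasieq \<sigma> q" and alg: "algebra_of \<sigma> A"
    and dist: "distributive_lattice (ConQ \<sigma> \<Sigma> A)" and mi: "rel_meet_irreducible \<sigma> \<Sigma> A \<Theta>"
    and a: "rel_congruence \<sigma> \<Sigma> A a" and b: "rel_congruence \<sigma> \<Sigma> A b" and ab: "a \<inter> b \<subseteq> \<Theta>"
  shows "a \<subseteq> \<Theta> \<or> b \<subseteq> \<Theta>"
proof -
  let ?J = "rel_Cg \<sigma> \<Sigma> A"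
  have \<Theta>: "rel_congruence \<sigma> \<Sigma> A \<Theta>" using mi by (simp add: rel_meet_irreducible_def)
  have J: "rel_congruence \<sigma> \<Sigma> A (?J (a \<union> \<Theta>))" "rel_congruence \<sigma> \<Sigma> A (?J (b \<union> \<Theta>))"
    using rel_congruence_join[OF wf alg] a b \<Theta> by blast+
  have sup: "a \<union> \<Theta> \<subseteq> ?J (a \<union> \<Theta>)" "b \<union> \<Theta> \<subseteq> ?J (b \<union> \<Theta>)" by (rule rel_Cg_superset)+
  then have "\<Theta> = ?J (a \<union> \<Theta>) \<inter> ?J (b \<union> \<Theta>)"
    using ConQ_join_Int[OF wf alg dist a b \<Theta> ab] by blast
  then have "\<Theta> = ?J (a \<union> \<Theta>) \<or> \<Theta> = ?J (b \<union> \<Theta>)"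
    using mi J unfolding rel_meet_irreducible_def by blast
  then show ?thesis using sup by auto
qed

section \<open>Relative and absolute finite subdirect irreducibility\<close>

text \<open>Distributivity is assumed for algebras on the type \<open>'a\<close> only, so the subalgebra of the cube of an
  algebra that occurs below has to be coded on \<open>'a\<close>.\<close>

lemma infinite_triple_code:
  includes cardinal_syntax
  assumes "infinite (UNIV :: 'a set)"
  obtains j :: "'a \<times> 'a \<times> 'a \<Rightarrow> 'a" where "inj j"
proof -
  have "|UNIV \<times> UNIV :: ('a \<times> 'a) set| =o |UNIV :: 'a set|"
    by (rule card_of_Times_same_infinite[OF assms])
  then obtain i :: "'a \<times> 'a \<Rightarrow> 'a" where "inj i"
    unfolding card_of_ordIso[symmetric] by (auto simp: bij_betw_def)
  then have "inj (i \<circ> map_prod id i)"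
    by (intro inj_compose prod.inj_map inj_on_id)
  with that show thesis by blast
qed

text \<open>Relative closure preserves the meet of two congruences as far as relative congruences can detect.
  The proof evaluates distributivity in the algebra \<open>D\<close> of triples described at the beginning; \<open>p\<close>,
  \<open>m\<close> and \<open>s\<close> are its first, middle and last projection.\<close>

lemma extension_principle:
  fixes A :: "('a, 'f) ualg"
  assumes wf: "\<forall>q \<in> \<Sigma>. wf_quasieq \<sigma> q" and inf: "infinite (UNIV :: 'a set)"
    and rcd: "rel_congruence_distributive TYPE('a) \<sigma> \<Sigma>"
    and A: "A \<in> quasivariety \<sigma> \<Sigma>"
    and \<phi>: "congruence \<sigma> A \<phi>" and \<theta>: "congruence \<sigma> A \<theta>" and \<Xi>: "rel_congruence \<sigma> \<Sigma> A \<Xi>"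
    and int: "\<phi> \<inter> \<theta> \<subseteq> \<Xi>"
  shows "rel_Cg \<sigma> \<Sigma> A \<phi> \<inter> rel_Cg \<sigma> \<Sigma> A \<theta> \<subseteq> \<Xi>"
proof -
  obtain j :: "'a \<times> 'a \<times> 'a \<Rightarrow> 'a" where j: "inj j" by (rule infinite_triple_code[OF inf])
  define p where "p = (\<lambda>u. fst (inv j u))"
  define m where "m = (\<lambda>u. fst (snd (inv j u)))"
  define s where "s = (\<lambda>u. snd (snd (inv j u)))"
  have coord [simp]: "p (j (x, y, z)) = x" "m (j (x, y, z)) = y" "s (j (x, y, z)) = z" for x y z
    using j by (simp_all add: p_def m_def s_def inv_f_f)
  define D :: "('a, 'f) ualg" where
    "D = \<lparr>carrier = {j (x, y, z) | x y z. (x, y) \<in> \<phi> \<and> (y, z) \<in> \<theta>},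
          opr = (\<lambda>f us. j (opr A f (map p us), opr A f (map m us), opr A f (map s us)))\<rparr>"
  have algA: "algebra_of \<sigma> A" using A by (simp add: quasivariety_iff)
  note \<phi>_props = equiv_props[OF congruence_equiv[OF \<phi>]]
  note \<theta>_props = equiv_props[OF congruence_equiv[OF \<theta>]]
  note sub = congruence_subset[OF \<phi>] congruence_subset[OF \<theta>]
  have inD: "j (x, y, z) \<in> carrier D" if "(x, y) \<in> \<phi>" "(y, z) \<in> \<theta>" for x y z
    using that by (auto simp: D_def)
  have D_rel: "(p u, m u) \<in> \<phi>" "(m u, s u) \<in> \<theta>" "u = j (p u, m u, s u)" if "u \<in> carrier D" for u
    using that by (auto simp: D_def)
  have diag: "j (x, x, x) \<in> carrier D" if "x \<in> carrier A" for x
    by (intro inD \<phi>_props(1) \<theta>_props(1) that)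
  have algD: "algebra_of \<sigma> D"
    unfolding algebra_of_def
  proof (intro conjI ballI impI)
    show "carrier D \<noteq> {}" using algA diag by (auto simp: algebra_of_def)
    fix f us assume f: "f \<in> symbols \<sigma>" and us: "us \<in> lists (carrier D)" "length us = arity \<sigma> f"
    have "list_all2 (\<lambda>x y. (x, y) \<in> \<phi>) (map p us) (map m us)"
      "list_all2 (\<lambda>x y. (x, y) \<in> \<theta>) (map m us) (map s us)"
      using us D_rel by (auto simp: list_all2_conv_all_nth)
    then have "(opr A f (map p us), opr A f (map m us)) \<in> \<phi>"
      "(opr A f (map m us), opr A f (map s us)) \<in> \<theta>"
      using congruence_opr[OF \<phi> f] congruence_opr[OF \<theta> f] us by simp_all
    from inD[OF this] show "opr D f us \<in> carrier D" by (simp add: D_def)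
  qed
  have hom: "hom_alg \<sigma> D A p" "hom_alg \<sigma> D A m" "hom_alg \<sigma> D A s"
    unfolding hom_alg_def using D_rel(1,2) sub by (auto simp: D_def)
  have D: "D \<in> quasivariety \<sigma> \<Sigma>"
  proof (rule quasivariety_separated[OF wf algD A, of "{p, m, s}"])
    fix u v assume "u \<in> carrier D" "v \<in> carrier D" "\<And>h. h \<in> {p, m, s} \<Longrightarrow> h u = h v"
    then show "u = v" using D_rel(3) by (metis insertCI)
  qed (use hom in auto)
  have surj: "m ` carrier D = carrier A"
  proof
    show "carrier A \<subseteq> m ` carrier D"
    proof
      fix x assume "x \<in> carrier A"
      then show "x \<in> m ` carrier D" using diag[of x] by (intro image_eqI[of _ _ "j (x, x, x)"]) auto
    qed
  qed (use hom_alg_closed[OF hom(2)] in auto)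
  have dist: "distributive_lattice (ConQ \<sigma> \<Sigma> D)"
    using rcd D by (simp add: rel_congruence_distributive_def)
  let ?J = "rel_Cg \<sigma> \<Sigma> D"
  define a where "a = pullback D p (Id_on (carrier A))"
  define b where "b = pullback D s (Id_on (carrier A))"
  define c where "c = pullback D m \<Xi>"
  have rel: "rel_congruence \<sigma> \<Sigma> D a" "rel_congruence \<sigma> \<Sigma> D b" "rel_congruence \<sigma> \<Sigma> D c"
    unfolding a_def b_def c_def
    using rel_congruence_pullback[OF wf _ algD algA] hom rel_congruence_Id_on[OF wf A] \<Xi> by blast+
  \<comment> \<open>The middle entry of a triple is determined by the outer ones up to \<open>\<phi> \<inter> \<theta>\<close>.\<close>
  have abc: "a \<inter> b \<subseteq> c"
  proof clarify
    fix u v assume "(u, v) \<in> a" "(u, v) \<in> b"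
    then have uv: "u \<in> carrier D" "v \<in> carrier D" "p u = p v" "s u = s v"
      by (auto simp: a_def b_def pullback_def)
    have "(m u, m v) \<in> \<phi>" using D_rel(1)[OF uv(1)] D_rel(1)[OF uv(2)] uv(3) \<phi>_props by metis
    moreover have "(m u, m v) \<in> \<theta>"
      using D_rel(2)[OF uv(1)] D_rel(2)[OF uv(2)] uv(4) \<theta>_props by metis
    ultimately show "(u, v) \<in> c" using int uv by (auto simp: c_def pullback_def)
  qed
  have kerc: "pullback D m Id \<subseteq> c"
    using hom_alg_closed[OF hom(2)]
      equiv_props(1)[OF congruence_equiv[OF rel_congruence_congruence[OF \<Xi>]]]
    by (auto simp: c_def pullback_def)
  \<comment> \<open>If \<open>d\<close> relates triples with middle entries \<open>x, y\<close> for every pair \<open>(x, y)\<close> of \<open>\<psi>\<close>, then the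
    relative congruence of \<open>A\<close> induced by \<open>d \<or> c\<close> along \<open>m\<close> contains \<open>\<psi>\<close>, hence its closure.\<close>
  have key: "(j (x, x, x), j (y, y, y)) \<in> ?J (d \<union> c)"
    if d: "rel_congruence \<sigma> \<Sigma> D d" and xy: "(x, y) \<in> rel_Cg \<sigma> \<Sigma> A \<psi>" "x \<in> carrier A" "y \<in> carrier A"
      and wit: "\<And>x y. (x, y) \<in> \<psi> \<Longrightarrow> \<exists>u v. (u, v) \<in> d \<and> m u = x \<and> m v = y" for d \<psi> x y
  proof -
    have "pullback D m Id \<subseteq> ?J (d \<union> c)" using kerc rel_Cg_superset[of "d \<union> c"] by blast
    note img = rel_congruence_image[OF wf hom(2) algD surj rel_congruence_join[OF wf algD d rel(3)]
        this]
    have "\<psi> \<subseteq> map_prod m m ` ?J (d \<union> c)"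
      using wit rel_Cg_superset[of "d \<union> c" \<sigma> \<Sigma> D] by fastforce
    then have "(x, y) \<in> map_prod m m ` ?J (d \<union> c)" using rel_Cg_least[OF img(2)] xy(1) by blast
    then have "(j (x, x, x), j (y, y, y)) \<in> pullback D m (map_prod m m ` ?J (d \<union> c))"
      using diag xy(2,3) unfolding pullback_def by simp
    then show ?thesis by (simp only: img(1))
  qed
  have wit_a: "\<exists>u v. (u, v) \<in> a \<and> m u = x \<and> m v = y" if "(x, y) \<in> \<phi>" for x y
  proof (intro exI conjI)
    have "x \<in> carrier A" "y \<in> carrier A" using that sub(1) by auto
    then show "(j (x, x, x), j (x, y, y)) \<in> a"
      using that diag inD[of x y y] \<theta>_props(1) by (auto simp: a_def pullback_def)
  qed simp_all
  have wit_b: "\<exists>u v. (u, v) \<in> b \<and> m u = x \<and> m v = y" if "(x, y) \<in> \<theta>" for x y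
  proof (intro exI conjI)
    have "x \<in> carrier A" "y \<in> carrier A" using that sub(2) by auto
    then show "(j (x, x, y), j (y, y, y)) \<in> b"
      using that diag inD[of x x y] \<phi>_props(1) by (auto simp: b_def pullback_def)
  qed simp_all
  show ?thesis
  proof clarify
    fix x y assume xy: "(x, y) \<in> rel_Cg \<sigma> \<Sigma> A \<phi>" "(x, y) \<in> rel_Cg \<sigma> \<Sigma> A \<theta>"
    have "x \<in> carrier A" "y \<in> carrier A"
      using xy(1) rel_congruence_subset[OF rel_congruence_rel_Cg[OF wf algA sub(1)]] by auto
    then have "(j (x, x, x), j (y, y, y)) \<in> ?J (a \<union> c) \<inter> ?J (b \<union> c)"
      using key[OF rel(1) xy(1)] key[OF rel(2) xy(2)] wit_a wit_b by blast
    then have "(j (x, x, x), j (y, y, y)) \<in> c"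
      using ConQ_join_Int[OF wf algD dist rel abc] by blast
    then show "(x, y) \<in> \<Xi>" by (simp add: c_def pullback_def)
  qed
qed

lemma RFSI_iff:
  assumes "\<forall>q \<in> \<Sigma>. wf_quasieq \<sigma> q"
  shows "A \<in> RFSI \<sigma> \<Sigma> \<longleftrightarrow>
    A \<in> quasivariety \<sigma> \<Sigma> \<and> rel_meet_irreducible \<sigma> \<Sigma> A (Id_on (carrier A))"
  using meet_irreducible_ConQ_iff[OF assms] by (auto simp: RFSI_def quasivariety_iff)

lemma FSI_subset_RFSI:
  fixes \<sigma> :: "'f signature"
  assumes wf: "\<forall>q \<in> \<Sigma>. wf_quasieq \<sigma> q"
  shows "(FSI \<sigma> \<Sigma> :: ('a, 'f) ualg set) \<subseteq> RFSI \<sigma> \<Sigma>"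
proof
  fix A :: "('a, 'f) ualg" assume "A \<in> FSI \<sigma> \<Sigma>"
  then have A: "A \<in> quasivariety \<sigma> \<Sigma>" and mi: "meet_irreducible (Con \<sigma> A) (Id_on (carrier A))"
    by (auto simp: FSI_def)
  then have alg: "algebra_of \<sigma> A" by (simp add: quasivariety_iff)
  show "A \<in> RFSI \<sigma> \<Sigma>"
    using A mi rel_congruence_Id_on[OF wf A] rel_congruence_congruence
    unfolding RFSI_iff[OF wf] rel_meet_irreducible_def meet_irreducible_Con_iff[OF alg] by blast
qed

text \<open>If two congruences meet in the diagonal, so do their relative closures by the extension principle;
  one closure is then the diagonal, and so is the congruence below it.\<close>

lemma RFSI_subset_FSI:
  assumes wf: "\<forall>q \<in> \<Sigma>. wf_quasieq \<sigma> q" and inf: "infinite (UNIV :: 'a set)"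
    and rcd: "rel_congruence_distributive TYPE('a) \<sigma> \<Sigma>"
  shows "(RFSI \<sigma> \<Sigma> :: ('a, 'f) ualg set) \<subseteq> FSI \<sigma> \<Sigma>"
proof
  fix A :: "('a, 'f) ualg" assume "A \<in> RFSI \<sigma> \<Sigma>"
  then have A: "A \<in> quasivariety \<sigma> \<Sigma>" and mi: "rel_meet_irreducible \<sigma> \<Sigma> A (Id_on (carrier A))"
    by (auto simp: RFSI_iff[OF wf])
  then have alg: "algebra_of \<sigma> A" by (simp add: quasivariety_iff)
  have Id: "rel_congruence \<sigma> \<Sigma> A (Id_on (carrier A))" by (rule rel_congruence_Id_on[OF wf A])
  have "Id_on (carrier A) = \<Phi> \<or> Id_on (carrier A) = \<Psi>"
    if con: "congruence \<sigma> A \<Phi>" "congruence \<sigma> A \<Psi>" and eq: "Id_on (carrier A) = \<Phi> \<inter> \<Psi>" for \<Phi> \<Psi>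
  proof -
    let ?C = "rel_Cg \<sigma> \<Sigma> A"
    have sup: "\<Phi> \<subseteq> ?C \<Phi>" "\<Psi> \<subseteq> ?C \<Psi>" by (rule rel_Cg_superset)+
    have "?C \<Phi> \<inter> ?C \<Psi> \<subseteq> Id_on (carrier A)"
      by (rule extension_principle[OF wf inf rcd A con Id]) (simp add: eq)
    then have "Id_on (carrier A) = ?C \<Phi> \<inter> ?C \<Psi>" using sup eq by blast
    moreover have "rel_congruence \<sigma> \<Sigma> A (?C \<Phi>)" "rel_congruence \<sigma> \<Sigma> A (?C \<Psi>)"
      using rel_congruence_rel_Cg[OF wf alg] con congruence_subset by blast+
    ultimately have "Id_on (carrier A) = ?C \<Phi> \<or> Id_on (carrier A) = ?C \<Psi>"
      using mi unfolding rel_meet_irreducible_def by blast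
    then show ?thesis using sup eq by blast
  qed
  then have "meet_irreducible (Con \<sigma> A) (Id_on (carrier A))"
    unfolding meet_irreducible_Con_iff[OF alg] using congruence_Id_on[OF alg] by blast
  with A show "A \<in> FSI \<sigma> \<Sigma>" by (simp add: FSI_def)
qed

section \<open>Congruence extension\<close>

lemma rel_congruence_maximal:
  assumes wf: "\<forall>q \<in> \<Sigma>. wf_quasieq \<sigma> q" and alg: "algebra_of \<sigma> A"
    and ne: "rel_congruence \<sigma> \<Sigma> A \<Theta>" "P \<Theta>"
    and ch: "\<And>S. subset.chain UNIV S \<Longrightarrow> S \<noteq> {} \<Longrightarrow> (\<And>\<Phi>. \<Phi> \<in> S \<Longrightarrow> P \<Phi>) \<Longrightarrow> P (\<Union>S)"
  obtains \<Psi> where "rel_congruence \<sigma> \<Sigma> A \<Psi>" "P \<Psi>"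
    "\<And>\<Phi>. rel_congruence \<sigma> \<Sigma> A \<Phi> \<Longrightarrow> P \<Phi> \<Longrightarrow> \<Psi> \<subseteq> \<Phi> \<Longrightarrow> \<Phi> = \<Psi>"
proof -
  let ?Z = "{\<Phi>. rel_congruence \<sigma> \<Sigma> A \<Phi> \<and> P \<Phi>}"
  have "\<Union>S \<in> ?Z" if "S \<noteq> {}" "subset.chain ?Z S" for S
  proof -
    have S: "subset.chain UNIV S" "\<And>\<Phi>. \<Phi> \<in> S \<Longrightarrow> rel_congruence \<sigma> \<Sigma> A \<Phi> \<and> P \<Phi>"
      using that(2) by (auto simp: subset_chain_def)
    then show ?thesis
      using rel_congruence_Union_chain[OF wf alg S(1) that(1)] ch[OF S(1) that(1)] by simp
  qed
  moreover have "?Z \<noteq> {}" using ne by auto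
  ultimately obtain \<Psi> where "\<Psi> \<in> ?Z" "\<forall>X \<in> ?Z. \<Psi> \<subseteq> X \<longrightarrow> X = \<Psi>"
    using subset_Zorn_nonempty[of ?Z] by blast
  then show thesis using that by blast
qed

lemma rel_meet_irreducible_separating:
  assumes wf: "\<forall>q \<in> \<Sigma>. wf_quasieq \<sigma> q" and alg: "algebra_of \<sigma> A"
    and \<Theta>: "rel_congruence \<sigma> \<Sigma> A \<Theta>" and st: "(s, t) \<notin> \<Theta>"
  obtains \<Xi> where "rel_meet_irreducible \<sigma> \<Sigma> A \<Xi>" "\<Theta> \<subseteq> \<Xi>" "(s, t) \<notin> \<Xi>"
proof -
  obtain \<Xi> where \<Xi>: "rel_congruence \<sigma> \<Sigma> A \<Xi>" "\<Theta> \<subseteq> \<Xi> \<and> (s, t) \<notin> \<Xi>"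
    and max: "\<And>\<Phi>. rel_congruence \<sigma> \<Sigma> A \<Phi> \<Longrightarrow> \<Theta> \<subseteq> \<Phi> \<and> (s, t) \<notin> \<Phi> \<Longrightarrow> \<Xi> \<subseteq> \<Phi> \<Longrightarrow> \<Phi> = \<Xi>"
    by (rule rel_congruence_maximal[OF wf alg \<Theta>, of "\<lambda>\<Phi>. \<Theta> \<subseteq> \<Phi> \<and> (s, t) \<notin> \<Phi>"])
      (use st in blast)+
  have "rel_meet_irreducible \<sigma> \<Sigma> A \<Xi>"
    unfolding rel_meet_irreducible_def
  proof (intro conjI allI impI)
    fix \<Phi> \<Psi> assume rel: "rel_congruence \<sigma> \<Sigma> A \<Phi>" "rel_congruence \<sigma> \<Sigma> A \<Psi>" and eq: "\<Xi> = \<Phi> \<inter> \<Psi>"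
    then have "(s, t) \<notin> \<Phi> \<or> (s, t) \<notin> \<Psi>" using \<Xi>(2) by blast
    then show "\<Xi> = \<Phi> \<or> \<Xi> = \<Psi>" using max[OF rel(1)] max[OF rel(2)] \<Xi>(2) eq by blast
  qed (rule \<Xi>(1))
  with that \<Xi>(2) show thesis by blast
qed

text \<open>The members of the classes considered live on the type \<open>'a\<close>, whereas the quotient algebra lives on
  sets. Its classes are therefore replaced by chosen representatives.\<close>

lemma quotient_copy:
  fixes B :: "('a, 'f) ualg"
  assumes alg: "algebra_of \<sigma> B" and con: "congruence \<sigma> B \<Psi>"
  obtains C :: "('a, 'f) ualg" and r where "hom_alg \<sigma> B C r" "r ` carrier B = carrier C"
    "pullback B r Id = \<Psi>"
proof -
  note eq = congruence_equiv[OF con]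
  define r where "r x = (SOME y. (x, y) \<in> \<Psi>)" for x
  define C :: "('a, 'f) ualg" where
    "C = \<lparr>carrier = r ` carrier B, opr = (\<lambda>f xs. r (opr B f xs))\<rparr>"
  have r_rel: "(x, r x) \<in> \<Psi>" if "x \<in> carrier B" for x
    unfolding r_def using equiv_props(1)[OF eq that] by (rule someI)
  have r_eq: "r x = r y" if "(x, y) \<in> \<Psi>" for x y
  proof -
    have "(x, z) \<in> \<Psi> \<longleftrightarrow> (y, z) \<in> \<Psi>" for z
      using that equiv_props(2,3)[OF eq] by blast
    then show ?thesis by (simp add: r_def)
  qed
  have "hom_alg \<sigma> B C r"
    unfolding hom_alg_def
  proof (intro conjI ballI impI)
    fix f xs assume f: "f \<in> symbols \<sigma>" and xs: "xs \<in> lists (carrier B)" "length xs = arity \<sigma> f"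
    have "list_all2 (\<lambda>x y. (x, y) \<in> \<Psi>) xs (map r xs)"
      using xs r_rel by (auto simp: list_all2_conv_all_nth)
    from r_eq[OF congruence_opr[OF con f xs(2) this]]
    show "r (opr B f xs) = opr C f (map r xs)" by (simp add: C_def)
  qed (simp add: C_def)
  moreover have "r ` carrier B = carrier C" by (simp add: C_def)
  moreover have "pullback B r Id = \<Psi>"
  proof
    show "pullback B r Id \<subseteq> \<Psi>"
    proof clarify
      fix x y assume "(x, y) \<in> pullback B r Id"
      then have "(x, r x) \<in> \<Psi>" "(y, r x) \<in> \<Psi>"
        using r_rel[of x] r_rel[of y] by (simp_all add: pullback_def)
      then show "(x, y) \<in> \<Psi>" using equiv_props(2,3)[OF eq] by blast
    qed
    show "\<Psi> \<subseteq> pullback B r Id"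
      using r_eq congruence_subset[OF con] by (auto simp: pullback_def)
  qed
  ultimately show thesis using that by blast
qed

text \<open>By the correspondence theorem, a decomposition of the diagonal of \<open>C\<close> pulls back to one of the
  kernel of \<open>r\<close>.\<close>

lemma RFSI_image:
  assumes wf: "\<forall>q \<in> \<Sigma>. wf_quasieq \<sigma> q" and alg: "algebra_of \<sigma> B"
    and hom: "hom_alg \<sigma> B C r" and surj: "r ` carrier B = carrier C"
    and mi: "rel_meet_irreducible \<sigma> \<Sigma> B (pullback B r Id)"
  shows "C \<in> RFSI \<sigma> \<Sigma>"
proof -
  have algC: "algebra_of \<sigma> C" by (rule algebra_of_surj_image[OF hom alg surj])
  have "quasi_closed \<Sigma> B (pullback B r Id)"
    using mi rel_congruence_iff[OF wf alg] by (auto simp: rel_meet_irreducible_def)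
  then have C: "C \<in> quasivariety \<sigma> \<Sigma>"
    using quasi_closed_of_pullback[OF wf hom alg surj] algC by (simp add: quasivariety_iff)
  have ker: "pullback B r Id = pullback B r (Id_on (carrier C))"
    using hom_alg_closed[OF hom] by (auto simp: pullback_def)
  have inj: "\<Phi> = \<Psi>" if "pullback B r \<Phi> = pullback B r \<Psi>"
    "\<Phi> \<subseteq> carrier C \<times> carrier C" "\<Psi> \<subseteq> carrier C \<times> carrier C" for \<Phi> \<Psi>
  proof -
    have "map_prod r r ` pullback B r \<Gamma> = \<Gamma>" if "\<Gamma> \<subseteq> carrier C \<times> carrier C" for \<Gamma>
      using that unfolding surj[symmetric] pullback_def by force
    with that show ?thesis by metis
  qed
  have "Id_on (carrier C) = \<Phi> \<or> Id_on (carrier C) = \<Psi>"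
    if rel: "rel_congruence \<sigma> \<Sigma> C \<Phi>" "rel_congruence \<sigma> \<Sigma> C \<Psi>" and eq: "Id_on (carrier C) = \<Phi> \<inter> \<Psi>"
    for \<Phi> \<Psi>
  proof -
    have "pullback B r (Id_on (carrier C)) = pullback B r \<Phi> \<inter> pullback B r \<Psi>"
      unfolding eq by (auto simp: pullback_def)
    then have "pullback B r (Id_on (carrier C)) = pullback B r \<Phi> \<or>
        pullback B r (Id_on (carrier C)) = pullback B r \<Psi>"
      using mi rel_congruence_pullback[OF wf hom alg algC] rel
      unfolding rel_meet_irreducible_def ker by blast
    moreover have "Id_on (carrier C) \<subseteq> carrier C \<times> carrier C" by auto
    ultimately show ?thesis using inj rel_congruence_subset rel by metis
  qed
  then have "rel_meet_irreducible \<sigma> \<Sigma> C (Id_on (carrier C))"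
    using rel_congruence_Id_on[OF wf C] by (simp add: rel_meet_irreducible_def)
  with C show ?thesis by (simp add: RFSI_iff[OF wf])
qed

lemma subalgebra_hom: "subalgebra \<sigma> A B \<Longrightarrow> hom_alg \<sigma> A B (\<lambda>x. x)"
  by (simp add: subalgebra_def hom_alg_def)

lemma subalgebra_quasivariety:
  assumes "\<forall>q \<in> \<Sigma>. wf_quasieq \<sigma> q" "B \<in> quasivariety \<sigma> \<Sigma>" "subalgebra \<sigma> A B"
  shows "A \<in> quasivariety \<sigma> \<Sigma>"
  by (rule quasivariety_separated[OF assms(1) _ assms(2), of _ "{\<lambda>x. x}"])
    (use assms(3) subalgebra_hom in \<open>auto simp: subalgebra_def\<close>)

lemma rel_congruence_restrict:
  assumes wf: "\<forall>q \<in> \<Sigma>. wf_quasieq \<sigma> q" and alg: "algebra_of \<sigma> B" and sub: "subalgebra \<sigma> A B"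
    and rel: "rel_congruence \<sigma> \<Sigma> B \<Phi>"
  shows "rel_congruence \<sigma> \<Sigma> A (\<Phi> \<inter> carrier A \<times> carrier A)"
proof -
  have "pullback A (\<lambda>x. x) \<Phi> = \<Phi> \<inter> carrier A \<times> carrier A" by (auto simp: pullback_def)
  then show ?thesis
    using rel_congruence_pullback[OF wf subalgebra_hom[OF sub] _ alg rel] sub
    by (simp add: subalgebra_def)
qed

text \<open>Extension is carried out in the quotient \<open>C\<close> of \<open>B\<close> by \<open>\<Psi>\<close>, which contains the image of \<open>A\<close> as a
  subalgebra. The hypothesis \<open>\<Psi> \<inter> A\<^sup>2 \<subseteq> \<Theta>\<close> says that \<open>\<Theta>\<close> survives the passage to this image.\<close>

lemma extend_along_RFSI_quotient:
  fixes B :: "('a, 'f) ualg"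
  assumes wf: "\<forall>q \<in> \<Sigma>. wf_quasieq \<sigma> q"
    and cep: "class_has_CEP \<sigma> \<Sigma> (RFSI \<sigma> \<Sigma> :: ('a, 'f) ualg set)"
    and alg: "algebra_of \<sigma> B" and sub: "subalgebra \<sigma> A B"
    and mi: "rel_meet_irreducible \<sigma> \<Sigma> B \<Psi>"
    and \<Theta>: "rel_congruence \<sigma> \<Sigma> A \<Theta>" and \<Psi>\<Theta>: "\<Psi> \<inter> carrier A \<times> carrier A \<subseteq> \<Theta>"
  obtains \<Phi> where "rel_congruence \<sigma> \<Sigma> B \<Phi>" "\<Phi> \<inter> carrier A \<times> carrier A = \<Theta>"
proof -
  have "congruence \<sigma> B \<Psi>" using mi rel_congruence_congruence by (auto simp: rel_meet_irreducible_def)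
  then obtain C :: "('a, 'f) ualg" and r where hom: "hom_alg \<sigma> B C r"
    and surj: "r ` carrier B = carrier C" and ker: "pullback B r Id = \<Psi>"
    by (rule quotient_copy[OF alg])
  have algC: "algebra_of \<sigma> C" by (rule algebra_of_surj_image[OF hom alg surj])
  have algA: "algebra_of \<sigma> A" and AB: "carrier A \<subseteq> carrier B"
    using sub by (auto simp: subalgebra_def)
  define A' :: "('a, 'f) ualg" where "A' = \<lparr>carrier = r ` carrier A, opr = opr C\<rparr>"
  have homA: "hom_alg \<sigma> A A' r"
    unfolding hom_alg_def
  proof (intro conjI ballI impI)
    fix f xs assume f: "f \<in> symbols \<sigma>" and xs: "xs \<in> lists (carrier A)" "length xs = arity \<sigma> f"
    have "xs \<in> lists (carrier B)" using xs AB by auto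
    moreover have "opr A f xs = opr B f xs" using sub f xs by (simp add: subalgebra_def)
    ultimately show "r (opr A f xs) = opr A' f (map r xs)"
      using hom_alg_opr[OF hom f] xs(2) by (simp add: A'_def)
  qed (simp add: A'_def)
  have surjA: "r ` carrier A = carrier A'" by (simp add: A'_def)
  have subA: "subalgebra \<sigma> A' C"
    using algebra_of_surj_image[OF homA algA surjA] AB surj by (auto simp: subalgebra_def A'_def)
  have "pullback A r Id \<subseteq> \<Theta>" using ker \<Psi>\<Theta> AB by (auto simp: pullback_def)
  note img = rel_congruence_image[OF wf homA algA surjA \<Theta> this]
  have "C \<in> RFSI \<sigma> \<Sigma>" by (rule RFSI_image[OF wf alg hom surj]) (simp add: ker mi)
  then have "has_CEP \<sigma> \<Sigma> C" using cep by (simp add: class_has_CEP_def)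
  then obtain \<Phi> where \<Phi>: "rel_congruence \<sigma> \<Sigma> C \<Phi>"
    and eq: "\<Phi> \<inter> carrier A' \<times> carrier A' = map_prod r r ` \<Theta>"
    using subA img(2) unfolding has_CEP_def ConQ_def partial_object.simps mem_Collect_eq by blast
  have "pullback B r \<Phi> \<inter> carrier A \<times> carrier A = pullback A r (\<Phi> \<inter> carrier A' \<times> carrier A')"
    using AB surjA by (auto simp: pullback_def)
  also have "\<dots> = \<Theta>" by (simp only: eq img(1))
  finally show thesis using that rel_congruence_pullback[OF wf hom alg algC \<Phi>] by blast
qed

text \<open>A relative congruence \<open>\<Psi>\<close> of \<open>B\<close> maximal with \<open>\<Psi> \<inter> A\<^sup>2 \<subseteq> \<Theta>\<close> is meet-irreducible, because \<open>\<Theta>\<close> is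
  meet-prime among the relative congruences of \<open>A\<close>.\<close>

lemma extend_meet_irreducible:
  fixes B :: "('a, 'f) ualg"
  assumes wf: "\<forall>q \<in> \<Sigma>. wf_quasieq \<sigma> q"
    and rcd: "rel_congruence_distributive TYPE('a) \<sigma> \<Sigma>"
    and cep: "class_has_CEP \<sigma> \<Sigma> (RFSI \<sigma> \<Sigma> :: ('a, 'f) ualg set)"
    and B: "B \<in> quasivariety \<sigma> \<Sigma>" and sub: "subalgebra \<sigma> A B"
    and mi: "rel_meet_irreducible \<sigma> \<Sigma> A \<Theta>"
  obtains \<Phi> where "rel_congruence \<sigma> \<Sigma> B \<Phi>" "\<Phi> \<inter> carrier A \<times> carrier A = \<Theta>"
proof -
  let ?A2 = "carrier A \<times> carrier A"
  have A: "A \<in> quasivariety \<sigma> \<Sigma>" by (rule subalgebra_quasivariety[OF wf B sub])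
  have alg: "algebra_of \<sigma> A" "algebra_of \<sigma> B" using A B by (auto simp: quasivariety_iff)
  have dist: "distributive_lattice (ConQ \<sigma> \<Sigma> A)"
    using rcd A by (simp add: rel_congruence_distributive_def)
  have \<Theta>: "rel_congruence \<sigma> \<Sigma> A \<Theta>" using mi by (simp add: rel_meet_irreducible_def)
  have Id: "Id_on (carrier B) \<inter> ?A2 \<subseteq> \<Theta>"
    using equiv_props(1)[OF congruence_equiv[OF rel_congruence_congruence[OF \<Theta>]]] by auto
  obtain \<Psi> where \<Psi>: "rel_congruence \<sigma> \<Sigma> B \<Psi>" "\<Psi> \<inter> ?A2 \<subseteq> \<Theta>"
    and max: "\<And>\<Phi>. rel_congruence \<sigma> \<Sigma> B \<Phi> \<Longrightarrow> \<Phi> \<inter> ?A2 \<subseteq> \<Theta> \<Longrightarrow> \<Psi> \<subseteq> \<Phi> \<Longrightarrow> \<Phi> = \<Psi>"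
    by (rule rel_congruence_maximal[OF wf alg(2) rel_congruence_Id_on[OF wf B],
          of "\<lambda>\<Phi>. \<Phi> \<inter> ?A2 \<subseteq> \<Theta>"]) (use Id in blast)+
  have "rel_meet_irreducible \<sigma> \<Sigma> B \<Psi>"
    unfolding rel_meet_irreducible_def
  proof (intro conjI allI impI)
    fix \<Phi>1 \<Phi>2
    assume rel: "rel_congruence \<sigma> \<Sigma> B \<Phi>1" "rel_congruence \<sigma> \<Sigma> B \<Phi>2" and eq: "\<Psi> = \<Phi>1 \<inter> \<Phi>2"
    have "\<Phi>1 \<inter> ?A2 \<subseteq> \<Theta> \<or> \<Phi>2 \<inter> ?A2 \<subseteq> \<Theta>"
      by (rule rel_meet_irreducible_prime[OF wf alg(1) dist mi
            rel_congruence_restrict[OF wf alg(2) sub rel(1)]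
            rel_congruence_restrict[OF wf alg(2) sub rel(2)]])
        (use \<Psi>(2) eq in blast)
    then show "\<Psi> = \<Phi>1 \<or> \<Psi> = \<Phi>2" using max rel eq by blast
  qed (rule \<Psi>(1))
  from extend_along_RFSI_quotient[OF wf cep alg(2) sub this \<Theta> \<Psi>(2)] that show thesis by blast
qed

text \<open>The extension of \<open>\<Theta>\<close> is the intersection of all relative congruences of \<open>B\<close> containing it: a pair
  of \<open>A\<^sup>2\<close> outside \<open>\<Theta>\<close> is excluded by the extension of a meet-irreducible \<open>\<Xi>\<close> above \<open>\<Theta>\<close> that omits
  this pair.\<close>

lemma CEP_of_RFSI:
  fixes \<sigma> :: "'f signature"
  assumes wf: "\<forall>q \<in> \<Sigma>. wf_quasieq \<sigma> q"
    and rcd: "rel_congruence_distributive TYPE('a) \<sigma> \<Sigma>"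
    and cep: "class_has_CEP \<sigma> \<Sigma> (RFSI \<sigma> \<Sigma> :: ('a, 'f) ualg set)"
  shows "class_has_CEP \<sigma> \<Sigma> (quasivariety \<sigma> \<Sigma> :: ('a, 'f) ualg set)"
  unfolding class_has_CEP_def has_CEP_def
proof (intro ballI allI impI)
  fix B A :: "('a, 'f) ualg" and \<Theta>
  assume B: "B \<in> quasivariety \<sigma> \<Sigma>" and sub: "subalgebra \<sigma> A B"
    and "\<Theta> \<in> carrier (ConQ \<sigma> \<Sigma> A)"
  then have \<Theta>: "rel_congruence \<sigma> \<Sigma> A \<Theta>" by (simp add: ConQ_def)
  let ?A2 = "carrier A \<times> carrier A"
  have alg: "algebra_of \<sigma> A" "algebra_of \<sigma> B"
    using B sub by (auto simp: quasivariety_iff subalgebra_def)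
  \<comment> \<open>Listing the total relation makes it visible that the intersection is over a nonempty set.\<close>
  let ?S = "insert (carrier B \<times> carrier B) {\<Phi>. rel_congruence \<sigma> \<Sigma> B \<Phi> \<and> \<Theta> \<subseteq> \<Phi>}"
  have \<Theta>A: "\<Theta> \<subseteq> ?A2" by (rule rel_congruence_subset[OF \<Theta>])
  have AB: "?A2 \<subseteq> carrier B \<times> carrier B" using sub by (auto simp: subalgebra_def)
  have "(x, y) \<in> \<Theta>" if xy: "(x, y) \<in> \<Inter>?S" "(x, y) \<in> ?A2" for x y
  proof (rule ccontr)
    assume "(x, y) \<notin> \<Theta>"
    then obtain \<Xi> where \<Xi>: "rel_meet_irreducible \<sigma> \<Sigma> A \<Xi>" "\<Theta> \<subseteq> \<Xi>" "(x, y) \<notin> \<Xi>"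
      by (rule rel_meet_irreducible_separating[OF wf alg(1) \<Theta>])
    then obtain \<Phi> where "rel_congruence \<sigma> \<Sigma> B \<Phi>" "\<Phi> \<inter> ?A2 = \<Xi>"
      using extend_meet_irreducible[OF wf rcd cep B sub] by metis
    then show False using xy \<Xi>(2,3) by auto
  qed
  moreover have "\<Theta> \<subseteq> \<Inter>?S" using \<Theta>A AB by auto
  ultimately have "\<Inter>?S \<inter> ?A2 = \<Theta>" using \<Theta>A by auto
  moreover have "rel_congruence \<sigma> \<Sigma> B (\<Inter>?S)"
    by (rule rel_congruence_Inter[OF wf alg(2)]) (use rel_congruence_total[OF wf alg(2)] in auto)
  ultimately show "\<exists>\<Phi> \<in> carrier (ConQ \<sigma> \<Sigma> B). \<Phi> \<inter> ?A2 = \<Theta>" by (auto simp: ConQ_def)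
qed

theorem theorem2p3:
  fixes \<sigma> :: "'f signature" and \<Sigma> :: "'f quasieq set"
  assumes "\<forall>q \<in> \<Sigma>. wf_quasieq \<sigma> q"
    and "infinite (UNIV :: 'a set)"
    and "rel_congruence_distributive TYPE('a) \<sigma> \<Sigma>"
  shows "(RFSI \<sigma> \<Sigma> :: ('a, 'f) ualg set) = FSI \<sigma> \<Sigma> \<and>
    (class_has_CEP \<sigma> \<Sigma> (quasivariety \<sigma> \<Sigma> :: ('a, 'f) ualg set) \<longleftrightarrow>
     class_has_CEP \<sigma> \<Sigma> (RFSI \<sigma> \<Sigma> :: ('a, 'f) ualg set))"
proof (intro conjI iffI)
  show "(RFSI \<sigma> \<Sigma> :: ('a, 'f) ualg set) = FSI \<sigma> \<Sigma>"
    using RFSI_subset_FSI[OF assms] FSI_subset_RFSI[OF assms(1)] by (rule subset_antisym)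
  show "class_has_CEP \<sigma> \<Sigma> (RFSI \<sigma> \<Sigma> :: ('a, 'f) ualg set)"
    if "class_has_CEP \<sigma> \<Sigma> (quasivariety \<sigma> \<Sigma> :: ('a, 'f) ualg set)"
    using that by (auto simp: class_has_CEP_def RFSI_def)
  show "class_has_CEP \<sigma> \<Sigma> (quasivariety \<sigma> \<Sigma> :: ('a, 'f) ualg set)"
    if "class_has_CEP \<sigma> \<Sigma> (RFSI \<sigma> \<Sigma> :: ('a, 'f) ualg set)"
    by (rule CEP_of_RFSI[OF assms(1,3) that])
qed

end
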